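(* Let $r$ be a positive integer and let $\varepsilon>0$. Then there exist constants $C>0$ and $p_0$, depending only on $r$ and $\varepsilon$, such that for every prime $p\ge p_0$ and all pairwise distinct non-zero elements $a_1,\dots,a_r\in\mathbb{F}_p$, the number $N(a_1,\dots,a_r;p)$ of tuples $(\alpha_1,\dots,\alpha_r,\beta)$ of primitive roots modulo $p$ satisfying $$\alpha_1+\beta\equiv a_1,\ \dots,\ \alpha_r+\beta\equiv a_r \pmod p$$ satisfies $$\left|N(a_1,\dots,a_r;p)-\frac{\varphi(p-1)^{r+1}}{p^r}\right|\le C\,p^{\frac12+\varepsilon}.$$ Equivalently, $N(a_1,\dots,a_r;p)=\frac{\varphi^{r+1}(p-1)}{p^r}+O(p^{\frac12+\varepsilon})$.
   Context: $\mathbb{F}_p$ is the field with $p$ elements, identified with the residue classes modulo $p$. Primitive roots modulo $p$ are counted as residue classes modulo $p$ (equivalently, as integers in $\{1,\dots,p-1\}$), i.e. they are the generators of the multiplicative group $\mathbb{F}_p^\times$. $\varphi$ is the Euler totient function, and $\varphi^{r+1}(p-1)$ means $(\varphi(p-1))^{r+1}$. *)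

theory Defs
  imports Complex_Main "HOL-Number_Theory.Number_Theory"
    "HOL-Number_Theory.Residue_Primitive_Roots"
begin

(* Elements of F_p are represented by their least non-negative residues. The restriction to
   {1..p-1} is needed because residue_primroot holds for every integer in the residue class. *)

definition primitive_roots :: "nat \<Rightarrow> nat set" where
  "primitive_roots p = {g \<in> {1..p - 1}. residue_primroot p g}"

definition primroot_tuples :: "nat list \<Rightarrow> nat \<Rightarrow> (nat list \<times> nat) set" where
  "primroot_tuples as p =
     {(\<alpha>s, \<beta>). length \<alpha>s = length as \<and> set \<alpha>s \<subseteq> primitive_roots p \<and> \<beta> \<in> primitive_roots p \<and>
        (\<forall>i < length as. [\<alpha>s ! i + \<beta> = as ! i] (mod p))}"

definition num_primroot_tuples :: "nat list \<Rightarrow> nat \<Rightarrow> nat" where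
  "num_primroot_tuples as p = card (primroot_tuples as p)"

(* The set is finite, so card is the true number of tuples, not the default value 0. *)
lemma finite_primroot_tuples: "finite (primroot_tuples as p)"
proof (rule finite_subset)
  show "primroot_tuples as p \<subseteq>
      {\<alpha>s. set \<alpha>s \<subseteq> primitive_roots p \<and> length \<alpha>s = length as} \<times> primitive_roots p"
    by (auto simp: primroot_tuples_def)
  have "finite (primitive_roots p)"
    by (simp add: primitive_roots_def)
  then show "finite ({\<alpha>s. set \<alpha>s \<subseteq> primitive_roots p \<and> length \<alpha>s = length as} \<times> primitive_roots p)"
    by (intro finite_cartesian_product finite_lists_length_eq)
qed

end

theory Submission
  imports
    "HOL-Algebra.Algebraic_Closure_Type"
    "Berlekamp_Zassenhaus.Finite_Field"
    "HOL-Complex_Analysis.Complex_Analysis"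
    Defs
begin

text \<open>
  The tuples are counted by the elements x of F = F_p such that x and all the a_i - x are
  primitive. Put N = p - 1. Inclusion-exclusion over the primes dividing N turns "primitive"
  into a combination of indicators of d-th powers, d squarefree, and each of these is an average
  of characters. The trivial characters give the main term, and the weights have total absolute
  value 2 to the power (r + 1) omega(N), which is O(p^\<epsilon>)
  (two_power_prime_factors_bound). What remains is square root cancellation, with a constant
  depending on r alone, in every sum over x of a product of characters of the x - a, not all trivial,
  the points a being distinct. This is Weil's bound (weil_bound), and it is the bulk of the text.

  Weil's bound is the Riemann hypothesis for the Dirichlet L-function of the character
  P \<mapsto> \<chi>(P(a_1)^m_1 ... P(a_s)^m_s) on monic polynomials P over F. Its coefficient
  of degree n vanishes for n \<ge> s, because the values at s points can be prescribed
  independently (char_coeff_eq_0), so L is a polynomial of degree at most s - 1, and its linear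
  coefficient is the sum to be bounded. By unique factorization, the power sums S_n of its
  inverse roots are sums over the irreducible polynomials of degree dividing n
  (newton_identity). A bound S_n = O(p^(n/2)) keeps L'/L holomorphic in |z| < p^(-1/2); hence L
  has no zero there, and its linear coefficient has absolute value at most (s - 1) sqrt p
  (linear_coeff_of_power_sum_bound). The implied constant in the bound for S_n is lost in this
  passage: it may depend on p and on the character. So a crude point count is enough.

  That count is Stepanov's method in Bombieri's form. Let f = (a_1 - X)^m_1 ... (a_s - X)^m_s,
  let d be the order of \<chi>, and Q = p^n = R R' with R and R' powers of p. The roots of the
  irreducible polynomials of one class of values are elements x of the field with Q elements with
  f(x)^((Q-1)/d) = c. For polynomials P_ke over F consider
  \<^item> G = sum of P_ke X^(R' k) f^(e (R'-1)/d), over k < K and e < d.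

  Since raising to the R-th power is additive, G^R at such an x is, up to a power of f(x), the
  value of the polynomial H = sum of P_ke^R X^k c^e f^((d-1-e)(R-1)/d), whose degree is much
  smaller. Counting coefficients, the P_ke can be chosen with H = 0, so that G vanishes at all
  these x, whose number is therefore at most deg G = Q/d + O(sqrt Q)
  (card_power_class_le_degree). The d classes together make up Q, so an upper bound for each of
  them gives asymptotics for each of them (char_power_sum_bound).

  The delicate point is that G is not zero unless all P_ke are (frobenius_combination_nonzero). Modulo X^R', the
  polynomial u = f^((R'-1)/d) is a d-th root of the constant f(0) divided by f. A relation between
  its powers with coefficients of small degree gives, on taking the norm over the d-th roots of
  unity, a relation with the true d-th root of f(0)/f, which is excluded by Kummer theory because
  f is not an e-th power, up to a constant, for any divisor e > 1 of d (kummer_irreducible).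

  The algebra lives in type classes, so the estimate is first proved for every type whose
  cardinality is a prime. To reach all prime numbers, critical_prime is chosen to be a
  counterexample if there is one, and a type of that cardinality is defined.
\<close>

section \<open>Linear equations and Kummer theory\<close>

text \<open>
  Over a finite field this is the pigeonhole principle: two assignments of the unknowns have the
  same image, and their difference is a solution.
\<close>
lemma finite_field_homogeneous_system:
  fixes M :: "'i \<Rightarrow> 'j \<Rightarrow> 'a::finite_field"
  assumes "finite I" "finite J" "card I < card J"
  shows "\<exists>l. (\<exists>j\<in>J. l j \<noteq> 0) \<and> (\<forall>i\<in>I. (\<Sum>j\<in>J. l j * M i j) = 0)"
proof -
  define L where "L = (\<lambda>l. restrict (\<lambda>i. \<Sum>j\<in>J. l j * M i j) I)"
  let ?A = "J \<rightarrow>\<^sub>E (UNIV :: 'a set)" and ?B = "I \<rightarrow>\<^sub>E (UNIV :: 'a set)"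
  have q: "1 < CARD('a)"
    using card_mono[of UNIV "{0, 1::'a}"] by simp
  have "card ?B = CARD('a) ^ card I" "card ?A = CARD('a) ^ card J"
    using assms by (simp_all add: card_PiE)
  then have "card ?B < card ?A"
    using q assms(3) by simp
  moreover have "L ` ?A \<subseteq> ?B"
    by (auto simp: L_def)
  moreover have "finite ?B" using assms by (intro finite_PiE) auto
  ultimately have "\<not> inj_on L ?A"
    by (meson card_inj_on_le linorder_not_le)
  then obtain l l' where l: "l \<in> ?A" "l' \<in> ?A" "l \<noteq> l'" "L l = L l'"
    by (auto simp: inj_on_def)
  have "\<exists>j\<in>J. l j - l' j \<noteq> 0"
    using l by (metis PiE_ext eq_iff_diff_eq_0)
  moreover have "(\<Sum>j\<in>J. (l j - l' j) * M i j) = 0" if "i \<in> I" for i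
    using fun_cong[OF l(4), of i] that
    by (simp add: L_def left_diff_distrib sum_subtractf)
  ultimately show ?thesis by (intro exI[of _ "\<lambda>j. l j - l' j"]) auto
qed

interpretation to_ac: inj_idom_hom "to_ac :: 'a::field \<Rightarrow> 'a alg_closure"
  by unfold_locales auto
interpretation to_ac_poly: map_poly_inj_idom_hom "to_ac :: 'a::field \<Rightarrow> 'a alg_closure" ..
interpretation to_fract: inj_idom_hom "to_fract :: 'a::idom \<Rightarrow> 'a fract"
  by unfold_locales auto

text \<open>
  The embedding of F[X] into an algebraic closure of F(X).
\<close>
definition emb :: "'a::field poly \<Rightarrow> 'a poly fract alg_closure" where
  "emb f = to_ac (to_fract f)"

interpretation emb: inj_idom_hom "emb :: 'a::field poly \<Rightarrow> _"
  by unfold_locales (auto simp: emb_def)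
interpretation emb_poly: map_poly_inj_idom_hom "emb :: 'a::field poly \<Rightarrow> _" ..

lemma prod_mset_power:
  "(\<Prod>x\<in>#A. h x) ^ d = (\<Prod>x\<in>#A. (h x :: 'b::comm_semiring_1) ^ d)"
  by (induction A) (auto simp: power_mult_distrib)

lemma order_power_eq:
  "p \<noteq> 0 \<Longrightarrow> Polynomial.order a (p ^ n) = n * Polynomial.order a (p :: 'a::idom poly)"
  by (induction n) (auto simp: order_mult)

text \<open>
  A d-th root z of l/f over F(X) satisfies no equation of degree below d. All conjugates of z
  are d-th roots of l/f, so if m is the minimal polynomial of z, then the d-th power of its
  constant term is l/f to the power deg m, up to sign. Comparing orders of vanishing at the
  points a shows that d divides (deg m) ord_a f for all a, hence d divides deg m by the
  assumption full. That assumption says that the orders of f have no common factor with d.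
\<close>
lemma kummer_irreducible:
  fixes f :: "'a::field poly" and P :: "'a poly poly"
  assumes f: "f \<noteq> 0" and l: "l \<noteq> 0" and d: "d > 0"
    and full: "\<And>j. (\<forall>a. d dvd j * Polynomial.order a f) \<Longrightarrow> d dvd j"
    and z: "z ^ d * emb f = emb [:l:]"
    and P: "P \<noteq> 0" "degree P < d"
  shows "poly (map_poly emb P) z \<noteq> 0"
proof
  assume root: "poly (map_poly emb P) z = 0"
  define g where "g = to_fract [:l:] / to_fract f"
  have zg: "z ^ d = to_ac g"
    using z f by (auto simp: g_def emb_def field_simps)
  have g0: "g \<noteq> 0" using f l by (auto simp: g_def)
  let ?ev = "\<lambda>Q. poly (map_poly to_ac Q) z"
  define Vn where "Vn = (\<lambda>Q. Q \<noteq> 0 \<and> ?ev Q = 0)"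
  have "Vn (map_poly to_fract P)"
    using P root by (auto simp: Vn_def map_poly_map_poly o_def emb_def[abs_def])
  then obtain m where m: "Vn m" "\<And>Q. Vn Q \<Longrightarrow> degree m \<le> degree Q"
    using exists_least_iff[of "\<lambda>n. \<exists>Q. Vn Q \<and> degree Q = n"]
    by (metis not_le_imp_less)
  have m0: "m \<noteq> 0" "?ev m = 0" using m by (auto simp: Vn_def)
  have degm: "degree m < d"
    using m(2)[OF \<open>Vn (map_poly to_fract P)\<close>] P by simp
  have degm0: "degree m > 0"
  proof (rule ccontr)
    assume "\<not> degree m > 0"
    then obtain c where "m = [:c:]" by (auto elim: degree_eq_zeroE)
    then show False using m0 by simp
  qed
  \<comment> \<open>The least degree makes m divide Z^d - g, so every root of m is a d-th root of g.\<close>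
  define M where "M = Polynomial.monom 1 d - Polynomial.monom g 0"
  have evM: "?ev M = 0"
    by (simp add: M_def to_ac_poly.hom_minus poly_monom zg map_poly_monom)
  have "?ev (M mod m) = 0"
  proof -
    have "?ev M = ?ev (M div m * m + M mod m)" by simp
    then show ?thesis using evM m0
      by (simp only: to_ac_poly.hom_add to_ac_poly.hom_mult poly_add poly_mult) simp
  qed
  have "M mod m = 0"
  proof (rule ccontr)
    assume "M mod m \<noteq> 0"
    then show False
      using m(2)[of "M mod m"] \<open>?ev (M mod m) = 0\<close> degree_mod_less[of m M] m0
      by (auto simp: Vn_def)
  qed
  then obtain w where w: "M = m * w" by (metis dvd_def mod_eq_0_iff_dvd)
  obtain A where A: "size A = degree m"
     "map_poly to_ac m = smult (to_ac (lead_coeff m)) (\<Prod>x\<in>#A. [:-x, 1:])"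
    using alg_closed_imp_factorization[of "map_poly to_ac m"] m0 by auto
  have rootA: "x ^ d = to_ac g" if "x \<in># A" for x
  proof -
    have "[:-x,1:] dvd (\<Prod>x\<in>#A. [:-x, 1:])"
      using that by (auto intro!: dvd_prod_mset)
    then have "[:-x,1:] dvd map_poly to_ac m"
      unfolding A(2) by (intro dvd_smult)
    then have "poly (map_poly to_ac M) x = 0"
      by (simp add: w to_ac_poly.hom_mult poly_eq_0_iff_dvd)
    then show ?thesis
      by (simp add: M_def to_ac_poly.hom_minus poly_monom map_poly_monom)
  qed
  \<comment> \<open>The product of the roots, up to sign, lies in the base field.\<close>
  define c where "c = coeff m 0 / lead_coeff m"
  have "to_ac (coeff m 0) = to_ac (lead_coeff m) * poly (\<Prod>x\<in>#A. [:-x, 1:]) 0"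
    using arg_cong[OF A(2), of "\<lambda>p. poly p 0"] by (simp add: poly_0_coeff_0)
  also have "poly (\<Prod>x\<in>#A. [:-x, 1:]) 0 = (\<Prod>x\<in>#A. -x)"
    by (simp add: poly_prod_mset)
  finally have "to_ac c = (\<Prod>x\<in>#A. -x)"
    using m0 by (simp add: c_def)
  then have "to_ac (c ^ d) = (\<Prod>x\<in>#A. -x) ^ d" by simp
  also have "\<dots> = (\<Prod>x\<in>#A. (-x) ^ d)"
    by (rule prod_mset_power)
  also have "\<dots> = (\<Prod>x\<in>#A. (-1)^d * to_ac g)"
    by (intro arg_cong[of _ _ prod_mset] image_mset_cong, subst power_minus) (simp add: rootA)
  also have "\<dots> = to_ac (((-1)^d * g) ^ degree m)"
    using A(1) by (simp add: prod_mset_constant to_ac.hom_power to_ac.hom_uminus)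
  finally have cd: "c ^ d = ((-1)^d * g) ^ degree m" by (simp only: to_ac_eq_iff)
  obtain a b where ab: "c = Fraction_Field.Fract a b" "b \<noteq> 0" by (cases c) auto
  have c': "c = to_fract a / to_fract b" using ab by (simp add: Fract_conv_to_fract)
  define e where "e = (-1 :: 'a) ^ (d * degree m)"
  have ee: "to_fract [:e:] = (-1) ^ (d * degree m)"
  proof -
    have "[:e:] = (-1) ^ (d * degree m)"
      by (simp add: e_def flip: poly_const_pow) (simp add: one_pCons)
    then show ?thesis by (simp add: to_fract.hom_power)
  qed
  have "to_fract (a ^ d * f ^ degree m) = to_fract (smult (e * l ^ degree m) (b ^ d))"
  proof -
    have "to_fract a ^ d / to_fract b ^ d = to_fract [:e:] * (to_fract [:l:] ^ degree m / to_fract f ^ degree m)"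
      using cd by (simp add: c' g_def ee power_divide power_mult_distrib power_mult)
    then have "to_fract a ^ d * to_fract f ^ degree m = to_fract [:e:] * to_fract [:l:] ^ degree m * to_fract b ^ d"
      using f ab(2) by (simp add: field_simps)
    then have "to_fract (a ^ d * f ^ degree m) = to_fract ([:e:] * [:l:] ^ degree m * b ^ d)"
      by (simp only: to_fract_mult to_fract.hom_power)
    moreover have "[:e:] * [:l:] ^ degree m * b ^ d = smult (e * l ^ degree m) (b ^ d)"
      by (simp add: poly_const_pow mult.commute)
    ultimately show ?thesis by simp
  qed
  then have eq: "a ^ d * f ^ degree m = smult (e * l ^ degree m) (b ^ d)"
    by (simp only: to_fract_eq_iff)
  have e0: "e * l ^ degree m \<noteq> 0" using l by (simp add: e_def)
  have "a ^ d * f ^ degree m \<noteq> 0" unfolding eq using e0 ab(2) by simp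
  then have "a \<noteq> 0" using d by (auto simp: zero_power)
  have "d dvd degree m"
  proof (rule full, intro allI)
    fix x
    have "d * Polynomial.order x a + degree m * Polynomial.order x f = d * Polynomial.order x b"
      using arg_cong[OF eq, of "Polynomial.order x"] \<open>a \<noteq> 0\<close> f ab(2) e0
      by (simp add: order_mult order_smult order_power_eq)
    then show "d dvd degree m * Polynomial.order x f"
      by (metis dvd_add_right_iff dvd_triv_left)
  qed
  then show False using degm degm0 by (auto dest: dvd_imp_le)
qed


text \<open>
  Clearing denominators: if y^d = l/F, then a polynomial in y^d becomes a polynomial in l and F.
\<close>
lemma poly_sparse_eval:
  fixes Q :: "'b::comm_ring_1 poly"
  assumes d: "d > 0" and sparse: "\<And>n. \<not> d dvd n \<Longrightarrow> coeff Q n = 0"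
    and deg: "degree Q \<le> d * (d - 1)"
  shows "poly Q y * F ^ (d - 1) = (\<Sum>j<d. coeff Q (d * j) * (F * y ^ d) ^ j * F ^ (d - 1 - j))"
proof -
  have "poly Q y = (\<Sum>n\<le>d * (d - 1). coeff Q n * y ^ n)"
    unfolding poly_altdef using deg by (intro sum.mono_neutral_left) (auto simp: coeff_eq_0)
  also have "\<dots> = (\<Sum>n\<in>(\<lambda>j. d * j) ` {..<d}. coeff Q n * y ^ n)"
  proof (rule sum.mono_neutral_right)
    show "(\<lambda>j. d * j) ` {..<d} \<subseteq> {..d * (d - 1)}" by auto
    show "\<forall>i\<in>{..d * (d - 1)} - (\<lambda>j. d * j) ` {..<d}. coeff Q i * y ^ i = 0"
    proof
      fix i assume i: "i \<in> {..d * (d - 1)} - (\<lambda>j. d * j) ` {..<d}"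
      have "\<not> d dvd i"
      proof
        assume "d dvd i"
        then obtain j where j: "i = d * j" by auto
        then have "j \<le> d - 1" using i d by auto
        then have "j < d" using d by linarith
        then show False using i j by auto
      qed
      then show "coeff Q i * y ^ i = 0" using sparse by simp
    qed
  qed auto
  also have "\<dots> = (\<Sum>j<d. coeff Q (d * j) * y ^ (d * j))"
    using d by (subst sum.reindex) (auto simp: inj_on_def)
  finally have "poly Q y * F ^ (d - 1) = (\<Sum>j<d. coeff Q (d * j) * y ^ (d * j) * F ^ (d - 1))"
    by (simp add: sum_distrib_right)
  also have "\<dots> = (\<Sum>j<d. coeff Q (d * j) * (F * y ^ d) ^ j * F ^ (d - 1 - j))"
  proof (intro sum.cong refl)
    fix j assume "j \<in> {..<d}"
    then have "F ^ (d - 1) = F ^ j * F ^ (d - 1 - j)"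
      by (simp flip: power_add)
    then show "coeff Q (d * j) * y ^ (d * j) * F ^ (d - 1) = coeff Q (d * j) * (F * y ^ d) ^ j * F ^ (d - 1 - j)"
      by (simp add: power_mult_distrib power_mult mult_ac)
  qed
  finally show ?thesis .
qed

lemma coeff_degree_mult:
  fixes P Q :: "'b::comm_ring_1 poly poly"
  assumes "\<And>n. degree (coeff P n) \<le> a" "\<And>n. degree (coeff Q n) \<le> b"
  shows "degree (coeff (P * Q) n) \<le> a + b"
  unfolding coeff_mult
  by (intro degree_sum_le) (auto intro!: order.trans[OF degree_mult_le] add_mono assms)

lemma coeff_degree_prod:
  fixes P :: "'i \<Rightarrow> 'b::comm_ring_1 poly poly"
  assumes "\<And>i n. i \<in> A \<Longrightarrow> degree (coeff (P i) n) \<le> b"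
  shows "degree (coeff (prod P A) n) \<le> card A * b"
  using assms
proof (induction A arbitrary: n rule: infinite_finite_induct)
  case (insert x A)
  then show ?case
    using coeff_degree_mult[of "P x" b "prod P A" "card A * b"] by simp
qed (auto simp: coeff_1)

definition roots_of_unity :: "nat \<Rightarrow> 'a::field set" where
  "roots_of_unity d = {z. z ^ d = 1}"

lemma card_power_eq_le:
  fixes c :: "'a::field"
  assumes "n > 0"
  shows "finite {x. x ^ n = c}" "card {x. x ^ n = c} \<le> n"
proof -
  let ?P = "Polynomial.monom 1 n + Polynomial.monom (- c) 0"
  have deg: "degree ?P = n"
    using assms degree_monom_eq[of "1::'a" n]
    by (subst degree_add_eq_left) (auto intro!: le_less_trans[OF degree_monom_le])
  then have 0: "?P \<noteq> 0" using assms by auto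
  have eq: "{x. x ^ n = c} = {x. poly ?P x = 0}" by (simp add: poly_monom)
  show "finite {x. x ^ n = c}" "card {x. x ^ n = c} \<le> n"
    unfolding eq using poly_roots_finite[OF 0] card_poly_roots_bound[OF 0] deg by auto
qed

lemma dvd_diff_cancel_left:
  fixes a b c :: "'b::comm_ring_1"
  assumes "a dvd b - c" "a dvd b"
  shows "a dvd c"
  using dvd_diff[OF assms(2,1)] by simp

text \<open>
  Here u is a d-th root of l/f only modulo X^R. The norm N, the product of the P(\<zeta>Z)
  over the d-th roots of unity \<zeta>, is a polynomial in Z^d, so N(u) is congruent to h/f^(d-1),
  where h is a polynomial in X alone. Its degree is below R, so h = 0. Then N vanishes at an exact d-th
  root of l/f as well, and so does one of its factors, which contradicts kummer_irreducible.
\<close>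
lemma norm_poly_contradiction:
  fixes f u :: "'a::field poly" and P :: "'a poly poly"
  assumes d: "d > 0" and mu: "card (roots_of_unity d :: 'a set) = d"
    and f: "f \<noteq> 0" and l: "l \<noteq> 0"
    and full: "\<And>j. (\<forall>a. d dvd j * Polynomial.order a f) \<Longrightarrow> d dvd j"
    and u: "Polynomial.monom 1 R dvd f * u ^ d - [:l:]"
    and P: "P \<noteq> 0" "degree P < d" "\<And>n. degree (coeff P n) \<le> b"
    and Pu: "Polynomial.monom 1 R dvd poly P u"
    and R: "d * b + d * degree f < R"
  shows False
proof -
  let ?U = "roots_of_unity d :: 'a set"
  let ?X = "Polynomial.monom (1::'a) R"
  have finU: "finite ?U" using mu d card.infinite by fastforce
  define S where "S = (\<lambda>\<zeta>. pcompose P [:0, [:\<zeta>:]:])"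
  define N where "N = (\<Prod>\<zeta>\<in>?U. S \<zeta>)"
  have unit: "\<zeta> \<noteq> 0" if "\<zeta> \<in> ?U" for \<zeta>
    using that d by (auto simp: roots_of_unity_def zero_power)
  have cS: "coeff (S \<zeta>) n = smult (\<zeta> ^ n) (coeff P n)" for \<zeta> n
    by (simp add: S_def coeff_pcompose_linear poly_const_pow)
  have degS: "degree (S \<zeta>) = degree P" if "\<zeta> \<in> ?U" for \<zeta>
  proof (rule antisym)
    show "degree (S \<zeta>) \<le> degree P" by (rule degree_le) (simp add: cS coeff_eq_0)
    show "degree P \<le> degree (S \<zeta>)"
      using P(1) unit[OF that] by (intro le_degree) (auto simp: cS)
  qed
  have S0: "S \<zeta> \<noteq> 0" if "\<zeta> \<in> ?U" for \<zeta>
  proof -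
    have "coeff (S \<zeta>) (degree P) \<noteq> 0" using P(1) unit[OF that] by (simp add: cS)
    then show ?thesis by auto
  qed
  have inv: "smult (\<zeta> ^ n) (coeff N n) = coeff N n" if z: "\<zeta> \<in> ?U" for \<zeta> n
  proof -
    have "pcompose N [:0, [:\<zeta>:]:] = (\<Prod>x\<in>?U. pcompose (S x) [:0, [:\<zeta>:]:])"
      by (simp add: N_def pcompose_prod)
    also have "\<dots> = (\<Prod>x\<in>?U. S (x * \<zeta>))"
      by (intro prod.cong refl) (simp add: S_def pcompose_pCons mult.commute flip: pcompose_assoc)
    also have "\<dots> = N"
      unfolding N_def
    proof (rule prod.reindex_bij_betw)
      show "bij_betw (\<lambda>x. x * \<zeta>) ?U ?U"
        using unit[OF z] z
        by (intro bij_betwI[of _ _ _ "\<lambda>x. x / \<zeta>"])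
           (auto simp: roots_of_unity_def power_mult_distrib power_divide)
    qed
    finally have "coeff (pcompose N [:0, [:\<zeta>:]:]) n = coeff N n" by simp
    then show ?thesis by (simp add: coeff_pcompose_linear poly_const_pow)
  qed
  have sparse: "coeff N n = 0" if n: "\<not> d dvd n" for n
  proof -
    have "\<exists>\<zeta>\<in>?U. \<zeta> ^ n \<noteq> 1"
    proof (rule ccontr)
      assume "\<not> ?thesis"
      then have *: "\<zeta> ^ n = 1" if "\<zeta> \<in> ?U" for \<zeta> using that by auto
      have "?U \<subseteq> {x. x ^ (n mod d) = 1}"
      proof
        fix x assume x: "x \<in> ?U"
        have "x ^ n = (x ^ d) ^ (n div d) * x ^ (n mod d)"
          by (simp flip: power_mult power_add)
        then show "x \<in> {x. x ^ (n mod d) = 1}"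
          using x *[OF x] by (simp add: roots_of_unity_def)
      qed
      moreover have nd: "n mod d > 0" using n by (simp add: dvd_eq_mod_eq_0)
      ultimately have "d \<le> n mod d"
        using card_power_eq_le[OF nd, of "1::'a"] mu by (metis card_mono order.trans)
      then show False using d mod_less_divisor[of d n] by linarith
    qed
    then obtain \<zeta> where z: "\<zeta> \<in> ?U" "\<zeta> ^ n \<noteq> 1" by auto
    have "smult (\<zeta> ^ n - 1) (coeff N n) = 0"
      using inv[OF z(1), of n] by (simp add: smult_diff_left)
    then show ?thesis using z(2) by simp
  qed
  have degN: "degree N \<le> d * (d - 1)"
  proof -
    have "degree N \<le> (\<Sum>\<zeta>\<in>?U. degree (S \<zeta>))"
      unfolding N_def using degree_prod_sum_le[OF finU, of S] by (simp add: o_def)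
    also have "\<dots> \<le> d * (d - 1)"
      using sum_bounded_above[of ?U "\<lambda>\<zeta>. degree (S \<zeta>)" "d - 1"] degS P(2) mu by force
    finally show ?thesis .
  qed
  have cN: "degree (coeff N n) \<le> d * b" for n
  proof -
    have "degree (coeff (prod S ?U) n) \<le> card ?U * b"
    proof (rule coeff_degree_prod)
      show "degree (coeff (S \<zeta>) m) \<le> b" for \<zeta> m
        unfolding cS using P(3)[of m] degree_smult_le[of "\<zeta> ^ m" "coeff P m"] by linarith
    qed
    then show ?thesis unfolding N_def mu .
  qed
  \<comment> \<open>The value of the norm at a d-th root of l/f, multiplied by f^(d-1).\<close>
  define h where "h = (\<Sum>j<d. coeff N (d * j) * [:l:] ^ j * f ^ (d - 1 - j))"
  have Nu: "?X dvd poly N u"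
  proof -
    have "1 \<in> ?U" by (simp add: roots_of_unity_def)
    then have "S 1 dvd N" unfolding N_def by (rule dvd_prodI[OF finU])
    moreover have "S 1 = P" by (rule poly_eqI) (simp add: cS)
    ultimately have "P dvd N" by (simp only:)
    then obtain T where "N = P * T" by (elim dvdE)
    then show ?thesis using Pu by simp
  qed
  have "?X dvd h"
  proof -
    have "?X dvd (\<Sum>j<d. coeff N (d * j) * (f * u ^ d) ^ j * f ^ (d - 1 - j)) - h"
      unfolding h_def sum_subtractf[symmetric]
    proof (intro dvd_sum)
      fix j
      have "f * u ^ d - [:l:] dvd (f * u ^ d) ^ j - [:l:] ^ j"
        unfolding power_diff_sumr2 by (rule dvd_triv_left)
      with u have "?X dvd (f * u ^ d) ^ j - [:l:] ^ j" by (rule dvd_trans)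
      then have "?X dvd ((f * u ^ d) ^ j - [:l:] ^ j) * (coeff N (d * j) * f ^ (d - 1 - j))"
        by (rule dvd_mult2)
      then show "?X dvd coeff N (d * j) * (f * u ^ d) ^ j * f ^ (d - 1 - j) - coeff N (d * j) * [:l:] ^ j * f ^ (d - 1 - j)"
        by (simp add: algebra_simps)
    qed
    moreover have "?X dvd (\<Sum>j<d. coeff N (d * j) * (f * u ^ d) ^ j * f ^ (d - 1 - j))"
      using dvd_mult2[OF Nu, of "f ^ (d - 1)"] poly_sparse_eval[OF d sparse degN, of u f] by simp
    ultimately show ?thesis by (rule dvd_diff_cancel_left)
  qed
  moreover have "degree h \<le> d * b + d * degree f"
    unfolding h_def
  proof (intro degree_sum_le)
    fix j assume j: "j \<in> {..<d}"
    have "degree (coeff N (d * j) * [:l:] ^ j * f ^ (d - 1 - j)) \<le>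
            degree (coeff N (d * j)) + degree ([:l:] ^ j) + degree (f ^ (d - 1 - j))"
      by (intro order.trans[OF degree_mult_le] add_mono order_refl)
    also have "\<dots> \<le> d * b + 0 + d * degree f"
    proof (intro add_mono cN)
      show "degree ([:l:] ^ j) \<le> 0" by (simp add: poly_const_pow)
      have "degree (f ^ (d - 1 - j)) \<le> degree f * (d - 1 - j)" by (rule degree_power_le)
      also have "\<dots> \<le> degree f * d" by (intro mult_left_mono) auto
      finally show "degree (f ^ (d - 1 - j)) \<le> d * degree f" by (simp add: mult.commute)
    qed
    finally show "degree (coeff N (d * j) * [:l:] ^ j * f ^ (d - 1 - j)) \<le> d * b + d * degree f" by simp
  qed auto
  ultimately have h0: "h = 0"
    using R dvd_imp_degree_le[of ?X h] by (auto simp: degree_monom_eq)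
  obtain z where z0: "z ^ d = emb [:l:] / emb f"
    using nth_root_exists[OF d] by blast
  then have z: "z ^ d * emb f = emb [:l:]" using f by simp
  have "poly (map_poly emb N) z * emb f ^ (d - 1) =
          (\<Sum>j<d. coeff (map_poly emb N) (d * j) * (emb f * z ^ d) ^ j * emb f ^ (d - 1 - j))"
    using sparse degN by (intro poly_sparse_eval[OF d]) (auto simp: coeff_map_poly)
  also have "\<dots> = emb h"
    by (simp add: h_def emb.hom_sum emb.hom_mult emb.hom_power coeff_map_poly z mult.commute[of "emb f" "z ^ d"])
  finally have "poly (map_poly emb N) z = 0" using f by (simp add: h0)
  then obtain \<zeta> where ze: "\<zeta> \<in> ?U" "poly (map_poly emb (S \<zeta>)) z = 0"
    using finU by (auto simp: N_def emb_poly.hom_prod poly_prod)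
  show False
    using kummer_irreducible[OF f l d full z S0[OF ze(1)]] degS[OF ze(1)] P(2) ze(2) by simp
qed


section \<open>Stepanov's method\<close>

lemma frobenius_ac_add:
  fixes x y :: "'p::prime_card mod_ring alg_closure"
  shows "(x + y) ^ (CARD('p) ^ n) = x ^ (CARD('p) ^ n) + y ^ (CARD('p) ^ n)"
  using prime_card[where ?'a = 'p] by (intro freshmans_dream') simp_all

lemma mod_ring_power_card_power [simp]: "(x :: 'p::prime_card mod_ring) ^ (CARD('p) ^ n) = x"
  by (rule finite_field_power_card_power_eq_same[of _ n]) simp

lemma monom_dvd_of_poly_0_eq_0:
  fixes g :: "'a::field poly"
  assumes "poly g 0 = 0"
  shows "Polynomial.monom 1 n dvd g ^ n"
proof -
  have "Polynomial.monom 1 1 dvd g" using assms by (simp add: poly_eq_0_iff_dvd monom_altdef)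
  then have "Polynomial.monom 1 1 ^ n dvd g ^ n" by (rule dvd_power_same)
  then show ?thesis by (simp add: monom_power)
qed

text \<open>
  Since X^R is the R-th power of X, the terms with the least occurring k are determined
  modulo X^R after division by X^(Rk). This removes the sum over k and leaves a relation between
  the powers of u = f^((R-1)/d), where f u^d = f^R is congruent to the constant f(0).
\<close>
lemma frobenius_combination_nonzero:
  fixes f :: "'p::prime_card mod_ring poly" and P :: "nat \<Rightarrow> nat \<Rightarrow> 'p mod_ring poly"
  assumes d: "d > 0" and mu: "card (roots_of_unity d :: 'p mod_ring set) = d" and dR: "d dvd R - 1"
    and f: "poly f 0 \<noteq> 0"
    and full: "\<And>j. (\<forall>a. d dvd j * Polynomial.order a f) \<Longrightarrow> d dvd j"
    and R: "R = CARD('p) ^ n" and b: "d * b + d * degree f < R"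
    and degP: "\<And>k e. degree (P k e) \<le> b"
    and nz: "\<exists>k<K. \<exists>e<d. P k e \<noteq> 0"
  shows "(\<Sum>k<K. \<Sum>e<d. P k e * Polynomial.monom 1 (R * k) * f ^ (((R - 1) div d) * e)) \<noteq> 0"
proof
  let ?X = "\<lambda>n. Polynomial.monom (1 :: 'p mod_ring) n"
  define u where "u = f ^ ((R - 1) div d)"
  define W where "W = (\<lambda>k. \<Sum>e<d. P k e * u ^ e)"
  assume "(\<Sum>k<K. \<Sum>e<d. P k e * ?X (R * k) * f ^ (((R - 1) div d) * e)) = 0"
  then have sum0: "(\<Sum>k<K. ?X (R * k) * W k) = 0"
    by (simp add: W_def u_def sum_distrib_left mult_ac flip: power_mult)
  define k0 where "k0 = (LEAST k. \<exists>e<d. P k e \<noteq> 0)"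
  obtain k1 where k1: "k1 < K" "\<exists>e<d. P k1 e \<noteq> 0" using nz by auto
  have k0: "\<exists>e<d. P k0 e \<noteq> 0" unfolding k0_def using k1(2) by (rule LeastI)
  have "k0 \<le> k1" unfolding k0_def using k1(2) by (rule Least_le)
  then have k0K: "k0 < K" using k1 by simp
  have small: "W k = 0" if "k < k0" for k
    using not_less_Least[OF that[unfolded k0_def]] by (simp add: W_def)
  have "(\<Sum>k<K. ?X (R * k) * W k) = ?X (R * k0) * W k0 + (\<Sum>k\<in>{..<K}-{k0}. ?X (R * k) * W k)"
    using k0K by (simp add: sum.remove)
  moreover have "?X (R * k0) * ?X R dvd (\<Sum>k\<in>{..<K}-{k0}. ?X (R * k) * W k)"
  proof (intro dvd_sum)
    fix k assume "k \<in> {..<K}-{k0}"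
    then consider "k < k0" | "k \<ge> k0 + 1" by fastforce
    then show "?X (R * k0) * ?X R dvd ?X (R * k) * W k"
    proof cases
      case 2
      then obtain j where "k = k0 + 1 + j" using le_iff_add by blast
      then have "R * k = (R * k0 + R) + R * (k - k0 - 1)" by (simp add: algebra_simps)
      then have "?X (R * k) = ?X (R * k0) * ?X R * ?X (R * (k - k0 - 1))"
        by (simp add: mult_monom)
      then show ?thesis by simp
    qed (simp add: small)
  qed
  ultimately have "?X (R * k0) * ?X R dvd ?X (R * k0) * W k0"
    using sum0 by (simp add: eq_neg_iff_add_eq_0[symmetric])
  then have dvdW: "?X R dvd W k0" by (simp add: monom_eq_0_iff)
  define Q where "Q = (\<Sum>e<d. Polynomial.monom (P k0 e) e)"
  have cQ: "coeff Q m = (if m < d then P k0 m else 0)" for m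
    by (auto simp: Q_def coeff_sum)
  have "Q \<noteq> 0" using k0 cQ by (metis coeff_0)
  have degQ: "degree Q < d"
    by (rule ccontr) (use \<open>Q \<noteq> 0\<close> cQ[of "degree Q"] in auto)
  have "poly Q u = W k0" by (simp add: Q_def W_def poly_sum poly_monom)
  define l where "l = poly f 0"
  have "R > 0" using R by simp
  have "f * u ^ d = f ^ R"
    using dR \<open>R > 0\<close> by (simp add: u_def flip: power_mult power_Suc)
  also have "f ^ R - [:l:] = (f - [:l:]) ^ R"
  proof -
    have "f ^ R = ((f - [:l:]) + [:l:]) ^ R" by simp
    also have "\<dots> = (f - [:l:]) ^ R + [:l:] ^ R"
      unfolding R using prime_card[where ?'a = 'p] by (intro freshmans_dream') simp_all
    finally show ?thesis by (simp add: R poly_const_pow)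
  qed
  finally have "f * u ^ d - [:l:] = (f - [:l:]) ^ R" by simp
  then have "?X R dvd f * u ^ d - [:l:]"
    using monom_dvd_of_poly_0_eq_0[of "f - [:l:]" R] by (simp add: l_def)
  moreover have "degree (coeff Q m) \<le> b" for m by (simp add: cQ degP)
  moreover have "f \<noteq> 0" "l \<noteq> 0" using f by (auto simp: l_def)
  ultimately show False
    using norm_poly_contradiction[OF d mu _ _ full] \<open>Q \<noteq> 0\<close> degQ dvdW \<open>poly Q u = W k0\<close> b by metis
qed


abbreviation eval_ac :: "'a::field poly \<Rightarrow> 'a alg_closure \<Rightarrow> 'a alg_closure" where
  "eval_ac f x \<equiv> poly (map_poly to_ac f) x"

lemma eval_ac_const: "eval_ac [:c:] x = to_ac c"
  using map_poly_monom[of to_ac c 0] by (simp add: monom_0)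

text \<open>
  The elements x of the field with Q = p^n elements for which f(x)^((Q-1)/d) = c. The power
  is the norm of f(x) to the prime field, raised to (p-1)/d.
\<close>
definition power_class ::
    "'p::prime_card mod_ring poly \<Rightarrow> nat \<Rightarrow> nat \<Rightarrow> 'p mod_ring \<Rightarrow> 'p mod_ring alg_closure set" where
  "power_class f d n c =
     {x. x ^ (CARD('p) ^ n) = x \<and> eval_ac f x ^ ((CARD('p) ^ n - 1) div d) = to_ac c}"

lemma card_fixed_ac:
  assumes "CARD('p::prime_card) ^ n > 1"
  shows "finite {x :: 'p mod_ring alg_closure. x ^ (CARD('p) ^ n) = x}"
    "card {x :: 'p mod_ring alg_closure. x ^ (CARD('p) ^ n) = x} \<le> CARD('p) ^ n"
proof -
  let ?Q = "CARD('p) ^ n"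
  let ?P = "Polynomial.monom (1 :: 'p mod_ring alg_closure) ?Q + Polynomial.monom (-1) 1"
  have deg: "degree ?P = ?Q"
    using assms degree_monom_eq[of "1::'p mod_ring alg_closure" ?Q]
    by (subst degree_add_eq_left) (auto intro!: le_less_trans[OF degree_monom_le])
  then have 0: "?P \<noteq> 0" using assms by auto
  have eq: "{x. x ^ ?Q = x} = {x. poly ?P x = 0}" by (simp add: poly_monom)
  show "finite {x :: 'p mod_ring alg_closure. x ^ ?Q = x}"
    "card {x :: 'p mod_ring alg_closure. x ^ ?Q = x} \<le> ?Q"
    unfolding eq using poly_roots_finite[OF 0] card_poly_roots_bound[OF 0] deg by auto
qed

text \<open>
  Stepanov's construction. There are K d (b + 1) free coefficients in the auxiliary polynomial
  G, against R b + K + R deg f conditions. Coefficients from the prime field are fixed by the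
  R-th power map, which makes the conditions linear.
\<close>
lemma card_power_class_le_degree:
  fixes f :: "'p::prime_card mod_ring poly"
  assumes d: "d > 0" and mu: "card (roots_of_unity d :: 'p mod_ring set) = d"
    and f: "poly f 0 \<noteq> 0"
    and full: "\<And>j. (\<forall>a. d dvd j * Polynomial.order a f) \<Longrightarrow> d dvd j"
    and c: "c ^ d = (1 :: 'p mod_ring)"
    and R: "R = CARD('p) ^ i" and R': "R' = CARD('p) ^ n'" and n: "n = i + n'"
    and dR: "d dvd R - 1" and dR': "d dvd R' - 1" and Q1: "R' > 1"
    and b: "d * b + d * degree f < R'"
    and count: "R * b + K + degree f * R < K * d * (b + 1)"
  shows "card (power_class f d n c) \<le> b + R' * K + degree f * R'"
proof -
  let ?X = "\<lambda>n. Polynomial.monom (1 :: 'p mod_ring) n"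
  define m m' where "m = (R - 1) div d" and "m' = (R' - 1) div d"
  define J where "J = {..<K} \<times> {..<d} \<times> {..b}"
  define I where "I = {..<R * b + K + degree f * R}"
  \<comment> \<open>The contribution of the coefficient of X^j in P_ke to the polynomial H of small degree.\<close>
  define M where "M = (\<lambda>(k, e, j). ?X (R * j + k) * [:c ^ e:] * f ^ ((d - 1 - e) * m))"
  have R0: "R > 0" "R' > 0" by (simp_all add: R R')
  have dm: "d * m = R - 1" "d * m' = R' - 1" using dR dR' by (simp_all add: m_def m'_def)
  have "card I < card J" using count by (simp add: I_def J_def card_cartesian_product algebra_simps)
  moreover have "finite I" "finite J" by (auto simp: I_def J_def)
  ultimately obtain l where l: "\<exists>j\<in>J. l j \<noteq> 0" "\<forall>i\<in>I. (\<Sum>j\<in>J. l j * coeff (M j) i) = 0"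
    using finite_field_homogeneous_system[of I J "\<lambda>i j. coeff (M j) i"] by auto
  define H where "H = (\<Sum>j\<in>J. smult (l j) (M j))"
  have degH: "degree (M j) < R * b + K + degree f * R" if "j \<in> J" for j
  proof -
    obtain k e a where j: "j = (k, e, a)" by (cases j)
    have kea: "k < K" "e < d" "a \<le> b" using that by (auto simp: J_def j)
    have "degree (M j) \<le> degree (?X (R * a + k) * [:c ^ e:]) + degree (f ^ ((d - 1 - e) * m))"
      unfolding M_def j by (simp add: degree_mult_le)
    also have "degree (?X (R * a + k) * [:c ^ e:]) \<le> R * a + k"
      by (rule order.trans[OF degree_mult_le]) (simp add: degree_monom_eq)
    also have "degree (f ^ ((d - 1 - e) * m)) \<le> degree f * ((d - 1 - e) * m)" by (rule degree_power_le)
    also have "(d - 1 - e) * m \<le> d * m" by (intro mult_right_mono) auto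
    also have "d * m \<le> R" using dm by simp
    finally have "degree (M j) \<le> R * a + k + degree f * R" by simp
    moreover have "R * a \<le> R * b" using kea by simp
    ultimately show ?thesis using kea(1) by linarith
  qed
  have H0: "H = 0"
  proof (rule poly_eqI)
    fix i show "coeff H i = coeff 0 i"
    proof (cases "i \<in> I")
      case True then show ?thesis using l(2) by (simp add: H_def coeff_sum)
    next
      case False
      then have "coeff (M j) i = 0" if "j \<in> J" for j
        using degH[OF that] by (intro coeff_eq_0) (simp add: I_def)
      then show ?thesis by (simp add: H_def coeff_sum)
    qed
  qed
  define P where "P = (\<lambda>k e. if k < K \<and> e < d then (\<Sum>j\<le>b. Polynomial.monom (l (k, e, j)) j) else 0)"
  have cP: "coeff (P k e) j = (if k < K \<and> e < d \<and> j \<le> b then l (k, e, j) else 0)" for k e j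
    by (auto simp: P_def coeff_sum)
  have degP: "degree (P k e) \<le> b" for k e
    by (rule degree_le) (simp add: cP)
  define G where "G = (\<Sum>k<K. \<Sum>e<d. P k e * ?X (R' * k) * f ^ (m' * e))"
  have "G \<noteq> 0"
    unfolding G_def m'_def
  proof (rule frobenius_combination_nonzero[OF d mu dR' f full R' b degP])
    obtain k e j where kej: "k < K" "e < d" "j \<le> b" "l (k, e, j) \<noteq> 0"
      using l(1) by (auto simp: J_def)
    then have "coeff (P k e) j \<noteq> 0" by (simp add: cP)
    then have "P k e \<noteq> 0" by auto
    then show "\<exists>k<K. \<exists>e<d. P k e \<noteq> 0" using kej by auto
  qed
  have root: "eval_ac G x = 0" if "x \<in> power_class f d n c" for x
  proof -
    define F where "F = eval_ac f x"
    have RQ: "CARD('p) ^ n = R' * R" by (simp add: R R' n power_add)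
    have x: "x ^ (R' * R) = x" and Fc: "F ^ ((R' * R - 1) div d) = to_ac c"
      using that by (simp_all add: power_class_def F_def RQ)
    have mm: "m' * R + m = (R' * R - 1) div d"
    proof -
      have "d * (m' * R + m) = (R' - 1) * R + (R - 1)"
        by (simp add: distrib_left dm flip: mult.assoc)
      also have "\<dots> = R' * R - 1" using R0 by (cases R'; cases R) auto
      finally show ?thesis using d by (metis nonzero_mult_div_cancel_left less_not_refl)
    qed
    have "c \<noteq> 0" using c d by (auto simp: zero_power)
    moreover have "(R' * R - 1) div d > 0"
    proof -
      have "m' > 0" using dm(2) Q1 by (cases m') auto
      then show ?thesis unfolding mm[symmetric] using R0 by simp
    qed
    ultimately have F0: "F \<noteq> 0" using Fc by (auto simp: zero_power)
    have G: "eval_ac G x = (\<Sum>k<K. \<Sum>e<d. eval_ac (P k e) x * x ^ (R' * k) * F ^ (m' * e))"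
      by (simp add: G_def to_ac_poly.hom_sum to_ac_poly.hom_mult to_ac_poly.hom_power poly_sum
            map_poly_monom poly_monom F_def)
    have PR: "eval_ac (P k e) x ^ R = (\<Sum>j\<le>b. to_ac (l (k, e, j)) * x ^ (R * j))" if "k < K" "e < d" for k e
    proof -
      have "eval_ac (P k e) x = (\<Sum>j\<le>b. to_ac (l (k, e, j)) * x ^ j)"
        using that by (simp add: P_def to_ac_poly.hom_sum poly_sum map_poly_monom poly_monom)
      also have "\<dots> ^ R = (\<Sum>j\<le>b. (to_ac (l (k, e, j)) * x ^ j) ^ R)"
        unfolding R using prime_card[where ?'a = 'p] by (intro freshmans_dream_sum') simp_all
      also have "\<dots> = (\<Sum>j\<le>b. to_ac (l (k, e, j)) * x ^ (R * j))"
        by (intro sum.cong refl)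
           (simp add: power_mult_distrib R mult.commute flip: power_mult to_ac_power)
      finally show ?thesis .
    qed
    have "eval_ac G x ^ R = (\<Sum>k<K. \<Sum>e<d. (eval_ac (P k e) x * x ^ (R' * k) * F ^ (m' * e)) ^ R)"
      unfolding G R using prime_card[where ?'a = 'p]
      by (subst freshmans_dream_sum', simp, simp, intro sum.cong refl freshmans_dream_sum') simp_all
    then have "eval_ac G x ^ R * F ^ ((d - 1) * m) =
        (\<Sum>k<K. \<Sum>e<d. (eval_ac (P k e) x * x ^ (R' * k) * F ^ (m' * e)) ^ R * F ^ ((d - 1) * m))"
      by (simp add: sum_distrib_right)
    also have "\<dots> = (\<Sum>k<K. \<Sum>e<d. \<Sum>j\<le>b. to_ac (l (k, e, j)) * eval_ac (M (k, e, j)) x)"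
    proof (intro sum.cong refl)
      fix k e assume ke: "k \<in> {..<K}" "e \<in> {..<d}"
      have xk: "(x ^ (R' * k)) ^ R = x ^ k"
      proof -
        have "(x ^ (R' * k)) ^ R = (x ^ (R' * R)) ^ k" by (simp add: mult_ac flip: power_mult)
        then show ?thesis by (simp only: x)
      qed
      have Fe: "(F ^ (m' * e)) ^ R * F ^ ((d - 1) * m) = to_ac c ^ e * F ^ ((d - 1 - e) * m)"
      proof -
        have "d - 1 = e + (d - 1 - e)" using ke by simp
        then have "(d - 1) * m = e * m + (d - 1 - e) * m" by (metis add_mult_distrib)
        then have "m' * e * R + (d - 1) * m = (m' * R + m) * e + (d - 1 - e) * m"
          by (simp add: algebra_simps)
        then show ?thesis
          unfolding Fc[symmetric] mm[symmetric] by (simp only: flip: power_mult power_add)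
      qed
      have "(eval_ac (P k e) x * x ^ (R' * k) * F ^ (m' * e)) ^ R * F ^ ((d - 1) * m) =
            eval_ac (P k e) x ^ R * (x ^ (R' * k)) ^ R * ((F ^ (m' * e)) ^ R * F ^ ((d - 1) * m))"
        by (simp only: power_mult_distrib mult.assoc)
      also have "\<dots> = (\<Sum>j\<le>b. to_ac (l (k, e, j)) * x ^ (R * j)) * x ^ k * (to_ac c ^ e * F ^ ((d - 1 - e) * m))"
        using ke by (simp only: PR xk Fe lessThan_iff)
      also have "\<dots> = (\<Sum>j\<le>b. to_ac (l (k, e, j)) * eval_ac (M (k, e, j)) x)"
        by (simp add: M_def sum_distrib_left sum_distrib_right eval_ac_const to_ac_poly.hom_mult to_ac_poly.hom_power
              map_poly_monom poly_monom F_def power_add mult_ac map_poly_pCons flip: poly_const_pow)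
      finally show "(eval_ac (P k e) x * x ^ (R' * k) * F ^ (m' * e)) ^ R * F ^ ((d - 1) * m) =
            (\<Sum>j\<le>b. to_ac (l (k, e, j)) * eval_ac (M (k, e, j)) x)" .
    qed
    also have "\<dots> = eval_ac H x"
      by (simp add: H_def J_def to_ac_poly.hom_sum poly_sum sum.cartesian_product' map_poly_smult)
    finally show ?thesis using F0 by (simp add: H0)
  qed
  have G0: "map_poly to_ac G \<noteq> 0" using \<open>G \<noteq> 0\<close> by simp
  have "card (power_class f d n c) \<le> card {x. eval_ac G x = 0}"
    using root poly_roots_finite[OF G0] by (intro card_mono) auto
  also have "\<dots> \<le> degree G" using card_poly_roots_bound[OF G0] by simp
  also have "\<dots> \<le> b + R' * K + degree f * R'"
    unfolding G_def
  proof (intro degree_sum_le)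
    fix k e assume ke: "k \<in> {..<K}" "e \<in> {..<d}"
    have "degree (P k e * ?X (R' * k) * f ^ (m' * e)) \<le> degree (P k e * ?X (R' * k)) + degree (f ^ (m' * e))"
      by (rule degree_mult_le)
    also have "degree (P k e * ?X (R' * k)) \<le> degree (P k e) + R' * k"
      by (rule order.trans[OF degree_mult_le]) (simp add: degree_monom_eq)
    also have "degree (f ^ (m' * e)) \<le> degree f * (m' * e)" by (rule degree_power_le)
    also have "m' * e \<le> m' * d" using ke by simp
    also have "m' * d \<le> R'" using dm by (simp add: mult.commute)
    finally have "degree (P k e * ?X (R' * k) * f ^ (m' * e)) \<le> degree (P k e) + R' * k + degree f * R'" by simp
    moreover have "R' * k \<le> R' * K" using ke by simp
    ultimately show "degree (P k e * ?X (R' * k) * f ^ (m' * e)) \<le> b + R' * K + degree f * R'"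
      using degP[of k e] by linarith
  qed auto
  finally show ?thesis .
qed


lemma dvd_power_minus_one:
  assumes "d dvd p - (1::nat)" "p > 0"
  shows "d dvd p ^ n - 1"
proof -
  have "[p ^ n = 1 ^ n] (mod d)"
    using assms by (intro cong_pow) (metis cong_altdef_nat cong_sym less_eq_Suc_le One_nat_def)
  then show ?thesis using assms(2) by (simp add: cong_altdef_nat)
qed

text \<open>
  The choice of parameters: R and R' are close to sqrt Q, the degree b of the coefficients is
  about R'/(2d), and K exceeds R/d by a constant t. The excess pays for the lower order terms
  in the number of conditions and costs only t R' in the degree of G. For small n the trivial bound Q is
  absorbed by the constant.
\<close>
lemma card_power_class_bound:
  fixes f :: "'p::prime_card mod_ring poly"
  assumes d: "d > 0" and mu: "card (roots_of_unity d :: 'p mod_ring set) = d"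
    and dp: "d dvd CARD('p) - 1"
    and f: "poly f 0 \<noteq> 0"
    and full: "\<And>j. (\<forall>a. d dvd j * Polynomial.order a f) \<Longrightarrow> d dvd j"
  shows "\<exists>C\<ge>0. \<forall>n>0. \<forall>c. c ^ d = 1 \<longrightarrow>
           real (card (power_class f d n c)) \<le> real CARD('p) ^ n / d + C * sqrt (real CARD('p) ^ n)"
proof -
  let ?p = "CARD('p)"
  define D where "D = degree f"
  define t where "t = 2 * ?p * (D + 1) + 1"
  define T where "T = t + 2 * d * D"
  define C where "C = real (1 + t + D + ?p * T)"
  have p: "?p > 1" using prime_card[where ?'a='p] prime_gt_1_nat by blast
  have "real (card (power_class f d n c)) \<le> real ?p ^ n / d + C * sqrt (real ?p ^ n)"
    if n: "n > 0" and c: "c ^ d = 1" for n c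
  proof -
    define i n' where "i = n - n div 2" and "n' = n div 2"
    define R R' where "R = ?p ^ i" and "R' = ?p ^ n'"
    have nn: "n = i + n'" by (simp add: i_def n'_def)
    have i: "i = n' \<or> i = Suc n'" unfolding i_def n'_def by linarith
    have R'R: "R' \<le> R" "R \<le> ?p * R'" using i p by (auto simp: R_def R'_def)
    have RQ: "?p ^ n = R * R'" by (simp add: R_def R'_def nn power_add)
    have sq: "real R' \<le> sqrt (real ?p ^ n)"
    proof (rule real_le_rsqrt)
      have "R' * R' \<le> R * R'" using R'R by simp
      then have "R' ^ 2 \<le> ?p ^ n" by (simp add: RQ power2_eq_square)
      then show "real R' ^ 2 \<le> real ?p ^ n" by (metis of_nat_le_iff of_nat_power)
    qed
    show ?thesis
    proof (cases "R' \<le> T")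
      case True
      have "card (power_class f d n c) \<le> card {x :: 'p mod_ring alg_closure. x ^ (?p ^ n) = x}"
        using one_less_power[OF p n] by (intro card_mono card_fixed_ac) (auto simp: power_class_def)
      also have "\<dots> \<le> ?p ^ n" using one_less_power[OF p n] by (intro card_fixed_ac) auto
      finally have "real (card (power_class f d n c)) \<le> real (?p ^ n)" by (simp only: of_nat_le_iff)
      also have "real (?p ^ n) = sqrt (real ?p ^ n) * sqrt (real ?p ^ n)" by simp
      also have "\<dots> \<le> (real ?p * T) * sqrt (real ?p ^ n)"
      proof (intro mult_right_mono real_sqrt_ge_zero)
        have "R * R' \<le> (?p * T) * (?p * T)"
          using R'R True p by (intro mult_mono) (auto intro: order.trans[OF R'R(2)] order.trans[OF True])
        then have "?p ^ n \<le> (?p * T) ^ 2" by (simp add: RQ power2_eq_square)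
        then have "real ?p ^ n \<le> (real ?p * T) ^ 2" by (metis of_nat_le_iff of_nat_power of_nat_mult)
        then show "sqrt (real ?p ^ n) \<le> real ?p * T" by (intro real_le_lsqrt) auto
      qed auto
      also have "\<dots> \<le> C * sqrt (real ?p ^ n)"
        by (intro mult_right_mono) (auto simp: C_def)
      also have "\<dots> \<le> real ?p ^ n / d + C * sqrt (real ?p ^ n)" by simp
      finally show ?thesis .
    next
      case False
      define b where "b = R' div (2 * d)"
      define K where "K = R div d + t"
      have b1: "2 * (d * b) \<le> R'" unfolding b_def by (metis mult.assoc times_div_less_eq_dividend)
      have b2: "R' < 2 * (d * (b + 1))"
        using d dividend_less_times_div[of "2 * d" R'] by (simp add: b_def mult.assoc)
      have R't: "2 * (d * D) < R'" "t < R'" using False by (auto simp: T_def)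
      have Kd: "R + (t - 1) * d < K * d + 1"
      proof -
        have "R < d * (R div d) + d" using dividend_less_times_div[OF d, of R] by simp
        moreover have "t * d = (t - 1) * d + d" by (simp add: t_def)
        ultimately show ?thesis by (simp add: K_def algebra_simps)
      qed
      have "card (power_class f d n c) \<le> b + R' * K + degree f * R'"
      proof (rule card_power_class_le_degree[OF d mu f full c R_def R'_def nn])
        show "d dvd R - 1" "d dvd R' - 1"
          unfolding R_def R'_def using p dp by (simp_all only: dvd_power_minus_one)
        show "R' > 1" using R't(2) by (simp add: t_def)
        show "d * b + d * degree f < R'" using b1 R't by (simp add: D_def)
        have "K \<le> R + t" by (simp add: K_def)
        have "R \<le> 2 * ?p * (d * (b + 1))"
        proof -
          have "R \<le> ?p * (2 * (d * (b + 1)))" using R'R(2) b2 by (meson less_imp_le mult_le_mono2 order.trans)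
          then show ?thesis by (simp add: algebra_simps)
        qed
        then have "(D + 1) * R \<le> (D + 1) * (2 * ?p * (d * (b + 1)))" by (intro mult_left_mono) auto
        also have "\<dots> = (t - 1) * d * (b + 1)" by (simp add: t_def algebra_simps)
        finally have 1: "(D + 1) * R \<le> (t - 1) * d * (b + 1)" .
        have "R * b + K + degree f * R \<le> R * b + (R + t) + D * R"
          using \<open>K \<le> R + t\<close> by (simp add: D_def)
        also have "\<dots> < R * b + R + R + D * R" using R't R'R by linarith
        also have "\<dots> = R * (b + 1) + (D + 1) * R" by (simp add: algebra_simps)
        also have "\<dots> \<le> (R + (t - 1) * d) * (b + 1)" using 1 by (simp add: algebra_simps)
        also have "\<dots> \<le> K * d * (b + 1)" using Kd by (intro mult_right_mono) auto
        finally show "R * b + K + degree f * R < K * d * (b + 1)" .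
      qed
      then have "real (card (power_class f d n c)) \<le> real (b + R' * K + degree f * R')"
        by (simp only: of_nat_le_iff)
      also have "\<dots> \<le> real R' + real R' * (real R / d + t) + D * real R'"
      proof -
        have "b \<le> R'" unfolding b_def by simp
        moreover have "real K \<le> real R / d + t" by (simp add: K_def of_nat_div_le_of_nat)
        then have "real R' * real K \<le> real R' * (real R / d + t)" by (intro mult_left_mono) auto
        ultimately show ?thesis by (simp add: D_def)
      qed
      also have "\<dots> = real ?p ^ n / d + real (1 + t + D) * real R'"
      proof -
        have "real ?p ^ n = real R * real R'" by (metis RQ of_nat_mult of_nat_power)
        then show ?thesis by (simp add: algebra_simps)
      qed
      also have "\<dots> \<le> real ?p ^ n / d + C * sqrt (real ?p ^ n)"
        by (intro add_left_mono mult_mono sq) (auto simp: C_def)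
      finally show ?thesis .
    qed
  qed
  moreover have "C \<ge> 0" by (simp add: C_def)
  ultimately show ?thesis by blast
qed


section \<open>Irreducible polynomials and their roots\<close>

lemma ac_fixed_in_range:
  fixes x :: "'p::prime_card mod_ring alg_closure"
  assumes "x ^ CARD('p) = x"
  shows "x \<in> range to_ac"
proof -
  let ?S = "{x :: 'p mod_ring alg_closure. x ^ (CARD('p) ^ 1) = x}"
  have p: "CARD('p) ^ 1 > 1" using prime_card[where ?'a='p] prime_gt_1_nat by auto
  have "range (to_ac :: 'p mod_ring \<Rightarrow> _) \<subseteq> ?S"
    using mod_ring_power_card_power[where ?'p='p and n = 1] by (auto simp flip: to_ac_power)
  moreover have "card (range (to_ac :: 'p mod_ring \<Rightarrow> _)) = CARD('p)"
    by (subst card_image) (auto intro: inj_to_ac)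
  ultimately have "range (to_ac :: 'p mod_ring \<Rightarrow> _) = ?S"
    using card_fixed_ac[OF p] by (intro card_seteq) auto
  then show ?thesis using assms by simp
qed

lemma frobenius_ac_diff:
  fixes x y :: "'p::prime_card mod_ring alg_closure"
  shows "(x - y) ^ (CARD('p) ^ n) = x ^ (CARD('p) ^ n) - y ^ (CARD('p) ^ n)"
  using frobenius_ac_add[of "x - y" y n] by simp

lemma eval_ac_frobenius:
  fixes g :: "'p::prime_card mod_ring poly"
  shows "eval_ac g x ^ (CARD('p) ^ n) = eval_ac g (x ^ (CARD('p) ^ n))"
proof -
  have ev: "eval_ac g z = (\<Sum>i\<le>degree g. to_ac (coeff g i) * z ^ i)" for z
    by (simp add: poly_altdef coeff_map_poly)
  have "eval_ac g x ^ (CARD('p) ^ n) = (\<Sum>i\<le>degree g. (to_ac (coeff g i) * x ^ i) ^ (CARD('p) ^ n))"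
    unfolding ev using prime_card[where ?'a = 'p] by (intro freshmans_dream_sum') simp_all
  also have "\<dots> = eval_ac g (x ^ (CARD('p) ^ n))"
    by (simp add: ev power_mult_distrib mult.commute flip: power_mult to_ac_power)
  finally show ?thesis .
qed

lemma prime_poly_lead_coeff:
  fixes P :: "'p::prime_card mod_ring poly"
  assumes "prime P"
  shows "lead_coeff P = 1"
proof -
  have "P \<noteq> 0" "normalize P = P" using assms by (auto simp: normalize_prime)
  then have "lead_coeff P = lead_coeff P div unit_factor (lead_coeff P)"
    by (metis coeff_normalize)
  then show ?thesis using \<open>P \<noteq> 0\<close> by (simp add: unit_factor_mod_ring_def)
qed

text \<open>
  The product of X - y' over the Frobenius orbit of y is fixed by Frobenius, so it has
  coefficients in the prime field and is divisible by P. As all of the orbit consists of roots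
  of P, the two polynomials agree.
\<close>
lemma prime_poly_conjugates:
  fixes P :: "'p::prime_card mod_ring poly"
  assumes P: "prime P" and y: "eval_ac P y = 0"
  shows "map_poly to_ac P = (\<Prod>i<degree P. [:- (y ^ (CARD('p) ^ i)), 1:])"
    and "inj_on (\<lambda>i. y ^ (CARD('p) ^ i)) {..<degree P}"
    and "y ^ (CARD('p) ^ degree P) = y"
proof -
  let ?p = "CARD('p)"
  define c where "c = (\<lambda>i. y ^ (?p ^ i))"
  have p: "?p > 1" using prime_card[where ?'a='p] prime_gt_1_nat by blast
  have P0: "P \<noteq> 0" using P by auto
  then have mP0: "map_poly to_ac P \<noteq> 0" by simp
  have cadd: "c (i + j) = c j ^ (?p ^ i)" for i j
    by (simp add: c_def power_add mult.commute flip: power_mult)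
  have cinj: "j = 0 \<or> c j = y" if "c i = c (i + j)" for i j
  proof -
    have "(y - c j) ^ (?p ^ i) = 0"
      using that cadd[of i j] by (simp add: frobenius_ac_diff c_def)
    then show ?thesis by simp
  qed
  have croot: "eval_ac P (c i) = 0" for i
    using y p by (simp add: c_def zero_power flip: eval_ac_frobenius)
  have fin: "finite {x. eval_ac P x = 0}" using poly_roots_finite[OF mP0] .
  have "\<exists>j>0. c j = y"
  proof -
    have "finite (range c)" using fin by (rule finite_subset[rotated]) (use croot in auto)
    then have "\<not> inj c" using finite_imageD by blast
    then obtain i j where "i < j" "c i = c j" by (metis injI linorder_neqE_nat)
    then show ?thesis using cinj[of i "j - i"] by (intro exI[of _ "j - i"]) auto
  qed
  then obtain e where e: "e > 0" "c e = y" and emin: "\<And>j. 0 < j \<Longrightarrow> j < e \<Longrightarrow> c j \<noteq> y"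
    using exists_least_iff[of "\<lambda>j. j > 0 \<and> c j = y"] by auto
  have inj: "inj_on c {..<e}"
  proof (rule linorder_inj_onI')
    fix i j assume ij: "i \<in> {..<e}" "j \<in> {..<e}" "i < j"
    then show "c i \<noteq> c j" using cinj[of i "j - i"] emin[of "j - i"] by auto
  qed
  define G where "G = (\<Prod>i<e. [:- c i, 1:])"
  have fr: "map_poly (\<lambda>x. x ^ ?p) G = G"
  proof -
    interpret fr: inj_idom_hom "\<lambda>x :: 'p mod_ring alg_closure. x ^ ?p"
      using frobenius_ac_add[where ?'p = 'p and n = 1] p
      by unfold_locales (auto simp: power_mult_distrib zero_power)
    interpret frp: map_poly_inj_idom_hom "\<lambda>x :: 'p mod_ring alg_closure. x ^ ?p" ..
    have "map_poly (\<lambda>x. x ^ ?p) G = (\<Prod>i<e. map_poly (\<lambda>x. x ^ ?p) [:- c i, 1:])"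
      by (simp add: G_def frp.hom_prod)
    also have "\<dots> = (\<Prod>i<e. [:- c (Suc i), 1:])"
    proof (intro prod.cong refl)
      fix i
      have "(- c i) ^ ?p = - c (Suc i)"
        using fr.hom_uminus[of "c i"] cadd[of 1 i] by simp
      then show "map_poly (\<lambda>x. x ^ ?p) [:- c i, 1:] = [:- c (Suc i), 1:]"
        by (simp add: fr.map_poly_pCons_hom)
    qed
    also have "\<dots> = (\<Prod>i<e. [:- c i, 1:])"
    proof -
      have ce: "c e = c 0" using e(2) by (simp add: c_def)
      obtain e' where e': "e = Suc e'" using e(1) by (cases e) auto
      have "(\<Prod>i<Suc e'. [:- c (Suc i), 1:]) = (\<Prod>i<e'. [:- c (Suc i), 1:]) * [:- c e, 1:]"
        unfolding e' by (rule prod.lessThan_Suc)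
      also have "\<dots> = [:- c 0, 1:] * (\<Prod>i<e'. [:- c (Suc i), 1:])"
        unfolding ce by (rule mult.commute)
      also have "\<dots> = (\<Prod>i<Suc e'. [:- c i, 1:])" by (rule prod.lessThan_Suc_shift[symmetric])
      finally show ?thesis unfolding e' .
    qed
    finally show ?thesis by (simp add: G_def)
  qed
  define g where "g = map_poly of_ac G"
  have gG: "map_poly to_ac g = G"
  proof (rule poly_eqI)
    fix n
    have "coeff G n ^ ?p = coeff G n"
      using arg_cong[OF fr, of "\<lambda>G. coeff G n"] p by (simp add: coeff_map_poly zero_power)
    then have "coeff G n \<in> range to_ac" by (rule ac_fixed_in_range)
    then show "coeff (map_poly to_ac g) n = coeff G n" by (simp add: g_def coeff_map_poly to_ac_of_ac)
  qed
  have G0: "G \<noteq> 0" by (simp add: G_def)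
  have degG: "degree G = e" by (simp add: G_def degree_prod_eq_sum_degree)
  have lcG: "lead_coeff G = 1" by (simp add: G_def lead_coeff_prod)
  have degg: "degree g = e" by (simp flip: gG degG)
  have "eval_ac g y = 0" unfolding gG G_def poly_prod using e by (auto simp: c_def intro!: bexI[of _ 0])
  have "P dvd g"
  proof (rule ccontr)
    assume "\<not> P dvd g"
    then have "coprime P g" using P by (intro prime_imp_coprime)
    then obtain u v where "u * P + v * g = 1"
      using bezout_coefficients[of P g] by (metis coprime_imp_gcd_eq_1 surj_pair)
    then have "eval_ac (u * P + v * g) y = 1" by simp
    then show False using y \<open>eval_ac g y = 0\<close> by (simp add: to_ac_poly.hom_add to_ac_poly.hom_mult)
  qed
  have "g \<noteq> 0" using gG G0 by auto
  have "e = card (c ` {..<e})" using inj by (simp add: card_image)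
  also have "\<dots> \<le> card {x. eval_ac P x = 0}" using fin croot by (intro card_mono) auto
  also have "\<dots> \<le> degree P" using card_poly_roots_bound[OF mP0] by simp
  finally have "e \<le> degree P" .
  moreover have "degree P \<le> e" using \<open>P dvd g\<close> \<open>g \<noteq> 0\<close> degg by (auto dest: dvd_imp_degree_le)
  ultimately have eP: "e = degree P" by simp
  obtain w where w: "g = P * w" using \<open>P dvd g\<close> by (elim dvdE)
  have "w \<noteq> 0" using w \<open>g \<noteq> 0\<close> by auto
  then have "degree w = 0" using w P0 degg eP by (simp add: degree_mult_eq)
  then obtain a where a: "w = [:a:]" by (auto elim: degree_eq_zeroE)
  have "to_ac (lead_coeff g) = lead_coeff G" by (simp add: coeff_map_poly degG degg flip: gG)
  then have "lead_coeff g = 1" using lcG by simp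
  moreover have "lead_coeff P = 1" using P by (rule prime_poly_lead_coeff)
  ultimately have "a = 1" using w a \<open>w \<noteq> 0\<close> by (simp add: lead_coeff_mult)
  then have "g = P" using w a by simp
  then show "map_poly to_ac P = (\<Prod>i<degree P. [:- (y ^ (CARD('p) ^ i)), 1:])"
    using gG by (simp add: G_def c_def eP)
  show "inj_on (\<lambda>i. y ^ (CARD('p) ^ i)) {..<degree P}" using inj by (simp add: c_def[abs_def] eP)
  show "y ^ (CARD('p) ^ degree P) = y" using e by (simp add: c_def eP)
qed


section \<open>Power sums over irreducible polynomials\<close>

definition monics :: "nat \<Rightarrow> 'p::prime_card mod_ring poly set" where
  "monics n = {f. lead_coeff f = 1 \<and> degree f = n}"

definition prime_polys_dvd :: "nat \<Rightarrow> 'p::prime_card mod_ring poly set" where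
  "prime_polys_dvd n = {P. prime P \<and> degree P dvd n}"

lemma monics_0: "monics 0 = {1}"
  by (auto simp: monics_def elim!: degree_eq_zeroE)

lemma monics_Suc: "monics (Suc n) = (\<lambda>(a, f). pCons a f) ` (UNIV \<times> monics n)"
proof (intro equalityI subsetI)
  fix g :: "'a mod_ring poly" assume g: "g \<in> monics (Suc n)"
  obtain a f where af: "g = pCons a f" by (cases g)
  with g have "f \<in> monics n" by (auto simp: monics_def split: if_splits)
  then show "g \<in> (\<lambda>(a, f). pCons a f) ` (UNIV \<times> monics n)" using af by auto
qed (auto simp: monics_def)

lemma finite_monics [simp]: "finite (monics n :: 'p::prime_card mod_ring poly set)"
  and card_monics: "card (monics n :: 'p::prime_card mod_ring poly set) = CARD('p) ^ n"
proof -
  have "finite (monics n :: 'p mod_ring poly set) \<and> card (monics n :: 'p mod_ring poly set) = CARD('p) ^ n"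
  proof (induction n)
    case 0 then show ?case by (simp add: monics_0)
  next
    case (Suc n)
    have "inj_on (\<lambda>(a, f). pCons a f) (UNIV \<times> (monics n :: 'p mod_ring poly set))"
      by (auto simp: inj_on_def)
    then show ?case using Suc by (simp add: monics_Suc card_image card_cartesian_product)
  qed
  then show "finite (monics n :: 'p mod_ring poly set)"
    "card (monics n :: 'p mod_ring poly set) = CARD('p) ^ n" by auto
qed

lemma prime_poly_degree_pos:
  assumes "prime (P :: 'p::prime_card mod_ring poly)"
  shows "degree P > 0"
  using assms by (metis bot_nat_0.not_eq_extremum is_unit_iff_degree not_prime_0 not_prime_unit)

lemma prime_poly_in_monics: "prime P \<Longrightarrow> P \<in> monics (degree P)"
  by (simp add: monics_def prime_poly_lead_coeff)

lemma finite_prime_polys_dvd: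
  assumes "n > 0"
  shows "finite (prime_polys_dvd n :: 'p::prime_card mod_ring poly set)"
proof (rule finite_subset)
  show "(prime_polys_dvd n :: 'p mod_ring poly set) \<subseteq> (\<Union>k\<le>n. monics k)"
    using assms prime_poly_in_monics by (fastforce simp: prime_polys_dvd_def dest: dvd_imp_le)
qed auto

text \<open>
  The polynomial analogue of log n being the sum of the von Mangoldt function over the divisors of n.
\<close>
lemma degree_eq_sum_prime_powers:
  fixes f :: "'p::prime_card mod_ring poly"
  assumes f: "f \<in> monics n"
  shows "n = (\<Sum>(P, j) | prime P \<and> j > 0 \<and> j * degree P \<le> n \<and> P ^ j dvd f. degree P)"
proof -
  have f0: "f \<noteq> 0" and deg: "degree f = n" using f by (auto simp: monics_def)
  have "f dvd prod_mset (prime_factorization f)" "prod_mset (prime_factorization f) dvd f"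
    using prod_mset_prime_factorization_weak[OF f0] by (metis normalize_dvd_iff dvd_refl dvd_normalize_iff)+
  moreover have "prod_mset (prime_factorization f) \<noteq> 0" by auto
  ultimately have "degree f = degree (prod_mset (prime_factorization f))"
    using f0 by (intro antisym dvd_imp_degree_le)
  also have "\<dots> = (\<Sum>P\<in>#prime_factorization f. degree P)"
  proof -
    have "\<forall>P\<in>#A. P \<noteq> 0 \<Longrightarrow> degree (prod_mset A) = (\<Sum>P\<in>#A. degree P)" for A :: "'p mod_ring poly multiset"
      by (induction A) (auto simp: degree_mult_eq prod_mset_zero_iff)
    moreover have "\<forall>P\<in>#prime_factorization f. P \<noteq> 0"
      by (metis in_prime_factors_imp_prime not_prime_0)
    ultimately show ?thesis by blast
  qed
  also have "\<dots> = (\<Sum>P\<in>prime_factors f. multiplicity P f * degree P)"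
  proof -
    have "(\<Sum>P\<in>#A. degree P) = (\<Sum>P\<in>set_mset A. count A P * degree P)" for A :: "'p mod_ring poly multiset"
    proof (induction A)
      case (add x A)
      have "(\<Sum>P\<in>set_mset (add_mset x A). count (add_mset x A) P * degree P) =
            (\<Sum>P\<in>insert x (set_mset A). (if P = x then degree P else 0) + count A P * degree P)"
        by (intro sum.cong) auto
      also have "\<dots> = degree x + (\<Sum>P\<in>insert x (set_mset A). count A P * degree P)"
        by (simp add: sum.distrib sum.delta')
      also have "(\<Sum>P\<in>insert x (set_mset A). count A P * degree P) = (\<Sum>P\<in>set_mset A. count A P * degree P)"
        by (intro sum.mono_neutral_right) (auto simp: not_in_iff)
      finally show ?case using add.IH by simp
    qed simp
    then have "(\<Sum>P\<in>#prime_factorization f. degree P) =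
               (\<Sum>P\<in>prime_factors f. count (prime_factorization f) P * degree P)" by blast
    also have "\<dots> = (\<Sum>P\<in>prime_factors f. multiplicity P f * degree P)"
      by (intro sum.cong refl) (simp add: count_prime_factorization_prime in_prime_factors_imp_prime)
    finally show ?thesis .
  qed
  also have "\<dots> = (\<Sum>P\<in>prime_factors f. \<Sum>j\<in>{1..multiplicity P f}. degree P)" by simp
  also have "\<dots> = (\<Sum>(P, j)\<in>(SIGMA P:prime_factors f. {1..multiplicity P f}). degree P)"
    by (rule sum.Sigma) auto
  also have "(SIGMA P:prime_factors f. {1..multiplicity P f}) =
             {(P, j). prime P \<and> j > 0 \<and> j * degree P \<le> n \<and> P ^ j dvd f}"
  proof -
    have "(P \<in> prime_factors f \<and> j \<in> {1..multiplicity P f}) \<longleftrightarrow>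
          (prime P \<and> j > 0 \<and> j * degree P \<le> n \<and> P ^ j dvd f)" for P j
    proof
      assume *: "P \<in> prime_factors f \<and> j \<in> {1..multiplicity P f}"
      then have P: "prime P" by auto
      have "P ^ j dvd f" using * by (auto intro: multiplicity_dvd')
      moreover from this have "j * degree P \<le> n"
        using dvd_imp_degree_le[OF _ f0, of "P ^ j"] P deg by (simp add: degree_power_eq mult.commute)
      ultimately show "prime P \<and> j > 0 \<and> j * degree P \<le> n \<and> P ^ j dvd f" using * P by auto
    next
      assume *: "prime P \<and> j > 0 \<and> j * degree P \<le> n \<and> P ^ j dvd f"
      then have "P dvd f" by (metis dvd_power dvd_trans)
      moreover have "j \<le> multiplicity P f"
        using * f0 by (metis multiplicity_geI not_prime_unit)
      ultimately show "P \<in> prime_factors f \<and> j \<in> {1..multiplicity P f}"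
        using * f0 by (auto simp: in_prime_factors_iff)
    qed
    then show ?thesis
      by (simp only: set_eq_iff split_paired_All mem_Sigma_iff mem_Collect_eq case_prod_conv) blast
  qed
  finally show ?thesis using deg by simp
qed

definition char_coeff :: "('p::prime_card mod_ring poly \<Rightarrow> 'b::comm_ring_1) \<Rightarrow> nat \<Rightarrow> 'b" where
  "char_coeff h n = (\<Sum>f\<in>monics n. h f)"

text \<open>
  The sum over the monic f of degree n of \<Lambda>(f) h(f), in terms of the irreducible P of which f is a power.
\<close>
definition char_power_sum :: "('p::prime_card mod_ring poly \<Rightarrow> 'b::comm_ring_1) \<Rightarrow> nat \<Rightarrow> 'b" where
  "char_power_sum h n = (\<Sum>P\<in>prime_polys_dvd n. of_nat (degree P) * h P ^ (n div degree P))"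

lemma sum_monics_multiples:
  fixes h :: "'p::prime_card mod_ring poly \<Rightarrow> 'b::comm_ring_1"
  assumes mult: "\<And>f g. h (f * g) = h f * h g" and g: "g \<in> monics k" and k: "k \<le> n"
  shows "(\<Sum>f\<in>{f \<in> monics n. g dvd f}. h f) = h g * char_coeff h (n - k)"
proof -
  have lg: "lead_coeff g = 1" "degree g = k" "g \<noteq> 0" using g by (auto simp: monics_def)
  have "(\<Sum>f\<in>{f \<in> monics n. g dvd f}. h f) = (\<Sum>f\<in>monics (n - k). h (g * f))"
  proof (rule sum.reindex_bij_witness[of _ "\<lambda>f. g * f" "\<lambda>f. f div g"])
    fix f assume "f \<in> {f \<in> monics n. g dvd f}"
    then have f: "lead_coeff f = 1" "degree f = n" and "g dvd f" by (auto simp: monics_def)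
    then obtain w where w: "f = g * w" by (elim dvdE)
    have "w \<noteq> 0" using w f by auto
    moreover have "lead_coeff w = 1" using w f lg by (metis lead_coeff_mult mult_1)
    ultimately show "f div g \<in> monics (n - k)"
      using w f lg by (auto simp: monics_def degree_mult_eq)
    show "g * (f div g) = f" using w lg by simp
    then show "h (g * (f div g)) = h f" by simp
  next
    fix f :: "'p mod_ring poly" assume f: "f \<in> monics (n - k)"
    then have "f \<noteq> 0" by (auto simp: monics_def)
    then have "degree (g * f) = n" "lead_coeff (g * f) = 1"
      using f lg k degree_mult_eq[OF lg(3), of f] lead_coeff_mult[of g f] by (auto simp: monics_def)
    then show "g * f \<in> {f \<in> monics n. g dvd f}"
      by (auto simp: monics_def)
    show "g * f div g = f" using lg by simp
  qed
  then show ?thesis by (simp add: mult char_coeff_def sum_distrib_left)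
qed

text \<open>
  This is the logarithmic derivative of the L-series of h. Weighting each f by its degree and
  writing the degree as a sum over the prime powers dividing f, one may sum over the cofactor first.
\<close>
lemma newton_identity:
  fixes h :: "'p::prime_card mod_ring poly \<Rightarrow> 'b::comm_ring_1"
  assumes mult: "\<And>f g. h (f * g) = h f * h g" and one: "h 1 = 1"
  shows "of_nat n * char_coeff h n = (\<Sum>k=1..n. char_power_sum h k * char_coeff h (n - k))"
proof -
  define PJ where "PJ = {(P :: 'p mod_ring poly, j :: nat). prime P \<and> j > 0 \<and> j * degree P \<le> n}"
  have hpow: "h (f ^ j) = h f ^ j" for f j by (induction j) (auto simp: mult one)
  have PJeq: "PJ = (\<lambda>(k, P). (P, k div degree P)) ` (SIGMA k:{1..n}. (prime_polys_dvd k :: 'p mod_ring poly set))"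
  proof (intro equalityI subsetI)
    fix x :: "'p mod_ring poly \<times> nat" assume "x \<in> PJ"
    then obtain P j where x: "x = (P, j)" "prime P" "j > 0" "j * degree P \<le> n" by (auto simp: PJ_def)
    have "degree P > 0" using x prime_poly_degree_pos by blast
    then show "x \<in> (\<lambda>(k, P). (P, k div degree P)) ` (SIGMA k:{1..n}. prime_polys_dvd k)"
      using x by (intro image_eqI[of _ _ "(j * degree P, P)"]) (auto simp: prime_polys_dvd_def)
  next
    fix x :: "'p mod_ring poly \<times> nat" assume "x \<in> (\<lambda>(k, P). (P, k div degree P)) ` (SIGMA k:{1..n}. prime_polys_dvd k)"
    then obtain k P where x: "x = (P, k div degree P)" "k \<in> {1..n}" "prime P" "degree P dvd k"
      by (auto simp: prime_polys_dvd_def)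
    then have "k div degree P > 0" using prime_poly_degree_pos[of P]
      by (auto simp: div_greater_zero_iff dest: dvd_imp_le)
    then show "x \<in> PJ" using x by (auto simp: PJ_def)
  qed
  have inj: "inj_on (\<lambda>(k, P). (P, k div degree P)) (SIGMA k:{1..n}. (prime_polys_dvd k :: 'p mod_ring poly set))"
    by (auto simp: inj_on_def prime_polys_dvd_def dvd_div_eq_iff)
  have finS: "finite (SIGMA k:{1..n}. (prime_polys_dvd k :: 'p mod_ring poly set))"
    by (intro finite_SigmaI) (auto intro: finite_prime_polys_dvd)
  then have finPJ: "finite PJ" unfolding PJeq by simp
  have "of_nat n * char_coeff h n = (\<Sum>f\<in>monics n. of_nat n * h f)"
    by (simp add: char_coeff_def sum_distrib_left)
  also have "\<dots> = (\<Sum>f\<in>monics n. \<Sum>(P, j)\<in>{x \<in> PJ. fst x ^ snd x dvd f}. of_nat (degree P) * h f)"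
  proof (intro sum.cong refl)
    fix f :: "'p mod_ring poly" assume f: "f \<in> monics n"
    have eq: "{x \<in> PJ. fst x ^ snd x dvd f} = {(P, j). prime P \<and> j > 0 \<and> j * degree P \<le> n \<and> P ^ j dvd f}"
      by (auto simp: PJ_def)
    have "of_nat n * h f = of_nat (\<Sum>(P, j)\<in>{x \<in> PJ. fst x ^ snd x dvd f}. degree P) * h f"
      unfolding eq using degree_eq_sum_prime_powers[OF f] by simp
    then show "of_nat n * h f = (\<Sum>(P, j)\<in>{x \<in> PJ. fst x ^ snd x dvd f}. of_nat (degree P) * h f)"
      by (simp add: sum_distrib_right case_prod_unfold)
  qed
  also have "\<dots> = (\<Sum>(P, j)\<in>PJ. \<Sum>f\<in>{f \<in> monics n. P ^ j dvd f}. of_nat (degree P) * h f)"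
    using sum.swap_restrict[OF finite_monics finPJ, of "\<lambda>f x. of_nat (degree (fst x)) * h f" "\<lambda>f x. fst x ^ snd x dvd f" n]
    by (simp add: case_prod_unfold)
  also have "\<dots> = (\<Sum>(P, j)\<in>PJ. of_nat (degree P) * h P ^ j * char_coeff h (n - j * degree P))"
  proof (intro sum.cong refl, clarify)
    fix P :: "'p mod_ring poly" and j assume "(P, j) \<in> PJ"
    then have Pj: "prime P" "j * degree P \<le> n" by (auto simp: PJ_def)
    then have "degree (P ^ j) = j * degree P" "lead_coeff (P ^ j) = 1"
      using prime_poly_lead_coeff[of P] lead_coeff_power[of P j]
      by (auto simp: degree_power_eq)
    then have "P ^ j \<in> monics (j * degree P)" "j * degree P \<le> n"
      using Pj(2) by (auto simp: monics_def)
    then show "(\<Sum>f\<in>{f \<in> monics n. P ^ j dvd f}. of_nat (degree P) * h f) =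
               of_nat (degree P) * h P ^ j * char_coeff h (n - j * degree P)"
      using sum_monics_multiples[OF mult, of "P ^ j" "j * degree P" n]
      by (simp add: hpow mult.assoc flip: sum_distrib_left)
  qed
  also have "\<dots> = (\<Sum>(k, P)\<in>(SIGMA k:{1..n}. prime_polys_dvd k).
                     of_nat (degree P) * h P ^ (k div degree P) * char_coeff h (n - k))"
    unfolding PJeq sum.reindex[OF inj]
    by (intro sum.cong refl) (auto simp: prime_polys_dvd_def)
  also have "\<dots> = (\<Sum>k=1..n. char_power_sum h k * char_coeff h (n - k))"
    by (subst sum.Sigma[symmetric]) (auto simp: finite_prime_polys_dvd char_power_sum_def sum_distrib_right)
  finally show ?thesis .
qed

text \<open>
  The case of the trivial character, whose coefficients p^n determine the power sums.
\<close>
lemma sum_degree_prime_polys_dvd: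
  assumes "n > 0"
  shows "(\<Sum>P\<in>(prime_polys_dvd n :: 'p::prime_card mod_ring poly set). degree P) = CARD('p) ^ n"
proof -
  define h where "h = (\<lambda>_ :: 'p mod_ring poly. 1 :: int)"
  define T where "T = (\<lambda>n. char_power_sum h n)"
  let ?p = "int CARD('p)"
  have c: "char_coeff h n = ?p ^ n" for n by (simp add: char_coeff_def h_def card_monics)
  have N: "int n * ?p ^ n = (\<Sum>k=1..n. T k * ?p ^ (n - k))" for n
    using newton_identity[of h n] by (simp add: c T_def) (simp add: h_def)
  obtain n' where n': "n = Suc n'" using assms by (cases n) auto
  have "int n * ?p ^ n = T n + (\<Sum>k=1..n'. T k * ?p ^ (n - k))"
    unfolding N[of n] by (simp add: n')
  also have "(\<Sum>k=1..n'. T k * ?p ^ (n - k)) = ?p * (\<Sum>k=1..n'. T k * ?p ^ (n' - k))"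
    by (simp add: sum_distrib_left n' Suc_diff_le mult_ac)
  also have "\<dots> = ?p * (int n' * ?p ^ n')" by (simp only: N)
  finally have "T n = ?p ^ n" by (simp add: n' algebra_simps)
  then have "int (\<Sum>P\<in>(prime_polys_dvd n :: 'p mod_ring poly set). degree P) = int (CARD('p) ^ n)"
    by (simp add: T_def char_power_sum_def h_def)
  then show ?thesis by (simp only: of_nat_eq_iff)
qed


definition root_poly :: "'a::field set \<Rightarrow> ('a \<Rightarrow> nat) \<Rightarrow> 'a poly" where
  "root_poly I m = (\<Prod>a\<in>I. [:a, -1:] ^ m a)"

definition poly_value :: "'a::field set \<Rightarrow> ('a \<Rightarrow> nat) \<Rightarrow> 'a poly \<Rightarrow> 'a" where
  "poly_value I m P = (\<Prod>a\<in>I. poly P a ^ m a)"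

lemma order_root_poly:
  assumes "finite I" "a \<in> I"
  shows "Polynomial.order a (root_poly I m) = m a"
proof -
  let ?r = "\<Prod>b\<in>I - {a}. [:b, -1:] ^ m b"
  have eq: "root_poly I m = [:a, -1:] ^ m a * ?r"
    unfolding root_poly_def using assms by (rule prod.remove)
  have r: "poly ?r a \<noteq> 0" using assms by (auto simp: poly_prod)
  then have "?r \<noteq> 0" by auto
  moreover have "Polynomial.order a ([:a, -1:] ^ m a) = m a"
  proof -
    have "[:a, -1:] = smult (-1) [:-a, 1:]" by simp
    then have "[:a, -1:] ^ m a = smult ((-1) ^ m a) ([:-a, 1:] ^ m a)" by (simp only: smult_power)
    then show ?thesis by (simp add: order_smult order_power_n_n)
  qed
  ultimately show ?thesis using r unfolding eq by (simp add: order_mult order_0I)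
qed

lemma power_geometric_sum:
  fixes z :: "'b::comm_monoid_mult"
  assumes "z ^ (p ^ e) = z"
  shows "z ^ (\<Sum>i<e * k. p ^ i) = z ^ ((\<Sum>i<e. p ^ i) * k)"
proof (induction k)
  case (Suc k)
  have zfix: "z ^ (p ^ (e * k)) = z"
    by (induction k) (simp_all add: assms power_add power_mult)
  have "(\<Sum>i<e * Suc k. p ^ i) = (\<Sum>i<e * k. p ^ i) + p ^ (e * k) * (\<Sum>i<e. p ^ i)"
  proof -
    have "(\<Sum>i<a + b. p ^ i) = (\<Sum>i<a. p ^ i) + (\<Sum>i<b. p ^ (a + i))" for a b
      by (induction b) simp_all
    from this[of "e * k" e] have "(\<Sum>i<e * Suc k. p ^ i) = (\<Sum>i<e * k. p ^ i) + (\<Sum>i<e. p ^ (e * k + i))"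
      by (simp add: add.commute)
    then show ?thesis by (simp add: power_add sum_distrib_left)
  qed
  then have "z ^ (\<Sum>i<e * Suc k. p ^ i) = z ^ (\<Sum>i<e * k. p ^ i) * (z ^ (p ^ (e * k))) ^ (\<Sum>i<e. p ^ i)"
    by (simp add: power_add power_mult)
  then show ?case by (simp add: zfix Suc.IH flip: power_add) (simp add: algebra_simps)
qed simp

text \<open>
  The value of P at a point a of the prime field is the norm of a - y, and the norm from the
  field of degree n is the power n / deg P of the norm from the field generated by y.
\<close>
lemma prime_root_in_power_class:
  fixes P :: "'p::prime_card mod_ring poly"
  assumes P: "prime P" and y: "eval_ac P y = 0" and n: "degree P dvd n"
    and d: "d dvd CARD('p) - 1"
  shows "y \<in> power_class (root_poly I m) d n
               (poly_value I m P ^ (n div degree P * ((CARD('p) - 1) div d)))"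
proof -
  let ?p = "CARD('p)"
  define e k where "e = degree P" and "k = n div degree P"
  define s where "s = (\<Sum>i<e. ?p ^ i)"
  have nk: "n = e * k" using n by (simp add: e_def k_def)
  have ye: "y ^ (?p ^ e) = y" using prime_poly_conjugates(3)[OF P y] by (simp add: e_def)
  have yn: "y ^ (?p ^ n) = y" unfolding nk
    by (induction k) (simp_all add: ye power_add power_mult)
  define F where "F = eval_ac (root_poly I m) y"
  have Fe: "F ^ (?p ^ e) = F" by (simp add: F_def eval_ac_frobenius ye)
  have val: "to_ac (poly P a) = (to_ac a - y) ^ s" for a
  proof -
    have "to_ac (poly P a) = eval_ac P (to_ac a)" by simp
    also have "\<dots> = (\<Prod>i<e. to_ac a - y ^ (?p ^ i))"
      by (simp add: prime_poly_conjugates(1)[OF P y] poly_prod e_def)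
    also have "\<dots> = (\<Prod>i<e. (to_ac a - y) ^ (?p ^ i))"
      by (simp add: frobenius_ac_diff flip: to_ac_power)
    also have "\<dots> = (to_ac a - y) ^ s" by (simp add: s_def power_sum)
    finally show ?thesis .
  qed
  have "eval_ac [:a, -1:] y = to_ac a - y" for a :: "'p mod_ring"
    by (simp add: to_ac.map_poly_pCons_hom)
  then have "F = (\<Prod>a\<in>I. (to_ac a - y) ^ m a)"
    by (simp add: F_def root_poly_def to_ac_poly.hom_prod to_ac_poly.hom_power poly_prod)
  then have "to_ac (poly_value I m P) = F ^ s"
    by (simp add: poly_value_def to_ac_prod val prod_power_distrib mult.commute flip: power_mult)
  then have "to_ac (poly_value I m P ^ (k * ((?p - 1) div d))) = (F ^ (s * k)) ^ ((?p - 1) div d)"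
    by (simp flip: power_mult) (simp add: mult_ac)
  also have "F ^ (s * k) = F ^ (\<Sum>i<n. ?p ^ i)"
    unfolding s_def nk by (rule power_geometric_sum[OF Fe, symmetric])
  also have "(F ^ (\<Sum>i<n. ?p ^ i)) ^ ((?p - 1) div d) = F ^ ((?p ^ n - 1) div d)"
  proof -
    have "(?p - 1) * (\<Sum>i<n. ?p ^ i) = ?p ^ n - 1"
    proof -
      have "int ((?p - 1) * (\<Sum>i<n. ?p ^ i)) = int (?p ^ n - 1)"
        using power_diff_1_eq[of "int ?p" n] by (simp add: of_nat_diff Suc_leI)
      then show ?thesis by (simp only: of_nat_eq_iff)
    qed
    then have "(?p ^ n - 1) div d = (\<Sum>i<n. ?p ^ i) * ((?p - 1) div d)"
      using d by (metis div_mult_swap mult.commute)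
    then show ?thesis by (simp flip: power_mult)
  qed
  finally show ?thesis by (simp add: power_class_def yn F_def k_def)
qed

text \<open>
  Different irreducible polynomials have no common roots, and each has as many as its degree.
\<close>
lemma sum_degree_le_card_power_class:
  fixes I :: "'p::prime_card mod_ring set"
  assumes n: "n > 0" and d: "d dvd CARD('p) - 1"
  shows "(\<Sum>P | P \<in> prime_polys_dvd n \<and> poly_value I m P ^ (n div degree P * ((CARD('p) - 1) div d)) = c. degree P)
           \<le> card (power_class (root_poly I m) d n c)"
proof -
  let ?A = "{P. P \<in> prime_polys_dvd n \<and> poly_value I m P ^ (n div degree P * ((CARD('p) - 1) div d)) = c}"
  define Z where "Z = (\<lambda>P :: 'p mod_ring poly. {y. eval_ac P y = 0})"
  have fin: "finite ?A" using finite_prime_polys_dvd[OF n] by auto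
  have prime: "prime P" "degree P dvd n" if "P \<in> ?A" for P using that by (auto simp: prime_polys_dvd_def)
  have finZ: "finite (Z P)" if "prime P" for P
    using that unfolding Z_def by (intro poly_roots_finite) auto
  have deg: "degree P \<le> card (Z P)" if "prime P" for P
  proof -
    have "degree (map_poly to_ac P) > 0" using prime_poly_degree_pos[OF that] by simp
    then obtain y where y: "eval_ac P y = 0" using alg_closed_imp_poly_has_root by blast
    have "degree P = card ((\<lambda>i. y ^ (CARD('p) ^ i)) ` {..<degree P})"
      using prime_poly_conjugates(2)[OF that y] by (simp add: card_image)
    also have "\<dots> \<le> card (Z P)"
      using prime_poly_conjugates(1)[OF that y] finZ[OF that]
      by (intro card_mono) (auto simp: Z_def poly_prod)
    finally show ?thesis .
  qed
  have disj: "Z P \<inter> Z Q = {}" if "prime P" "prime Q" "P \<noteq> Q" for P Q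
  proof (rule ccontr)
    assume "Z P \<inter> Z Q \<noteq> {}"
    then obtain y where y: "eval_ac P y = 0" "eval_ac Q y = 0" by (auto simp: Z_def)
    have "coprime P Q" using that by (simp add: primes_coprime)
    then obtain u v where "u * P + v * Q = 1"
      using bezout_coefficients[of P Q] by (metis coprime_imp_gcd_eq_1 surj_pair)
    then have "eval_ac (u * P + v * Q) y = 1" by simp
    then show False using y by (simp add: to_ac_poly.hom_add to_ac_poly.hom_mult)
  qed
  have "(\<Sum>P\<in>?A. degree P) \<le> (\<Sum>P\<in>?A. card (Z P))"
    using deg prime by (intro sum_mono) auto
  also have "\<dots> = card (\<Union>P\<in>?A. Z P)"
    using fin finZ disj prime by (intro card_UN_disjoint[symmetric]) auto
  also have "\<dots> \<le> card (power_class (root_poly I m) d n c)"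
  proof (rule card_mono)
    have "CARD('p) ^ n > 1"
      using n prime_gt_1_nat[OF prime_card[where ?'a='p]] by (intro one_less_power)
    then show "finite (power_class (root_poly I m) d n c)"
      unfolding power_class_def using card_fixed_ac(1)[where ?'p='p] by auto
    show "(\<Union>P\<in>?A. Z P) \<subseteq> power_class (root_poly I m) d n c"
      using prime_root_in_power_class[OF prime(1) _ prime(2) d, where I = I and m = m] by (fastforce simp: Z_def)
  qed
  finally show ?thesis .
qed


section \<open>The size of the power sums and of the L-polynomial\<close>

lemma mod_ring_power_card_minus_one:
  assumes "(x :: 'p::prime_card mod_ring) \<noteq> 0"
  shows "x ^ (CARD('p) - 1) = 1"
proof -
  have "x * x ^ (CARD('p) - 1) = x ^ CARD('p)"
    using prime_gt_0_nat[OF prime_card[where ?'a='p]] by (simp flip: power_Suc)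
  also have "\<dots> = x * 1" using mod_ring_power_card_power[of x 1] by simp
  finally show ?thesis using assms by simp
qed

text \<open>
  The power sum is the sum of W(c) \<theta>(c) over the d-th roots of unity c, where W(c)
  counts the irreducible polynomials of class c with weight their degree. The upper bound
  W(c) \<le> Q/d + C sqrt Q holds for each c, and the sum of all W(c) is Q up to the contribution
  of the linear factors of f. Hence the deviations of the W(c) from Q/d have absolute values of
  sum O(sqrt Q), and Q/d itself is cancelled by the vanishing sum of \<theta>.
\<close>
lemma char_power_sum_bound:
  fixes I :: "'p::prime_card mod_ring set" and ch \<theta> :: "'p mod_ring \<Rightarrow> complex"
  assumes d: "d > 0" and mu: "card (roots_of_unity d :: 'p mod_ring set) = d"
    and dp: "d dvd CARD('p) - 1"
    and I0: "0 \<notin> I"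
    and full: "\<And>j. (\<forall>a\<in>I. d dvd j * m a) \<Longrightarrow> d dvd j"
    and mult: "\<And>x y. ch (x * y) = ch x * ch y" and one: "ch 1 = 1" and zero: "ch 0 = 0"
    and th: "\<And>x. x \<noteq> 0 \<Longrightarrow> ch x = \<theta> (x ^ ((CARD('p) - 1) div d))"
    and thsum: "(\<Sum>c\<in>roots_of_unity d. \<theta> c) = 0"
    and thnorm: "\<And>c. c \<in> roots_of_unity d \<Longrightarrow> norm (\<theta> c) \<le> 1"
  shows "\<exists>C\<ge>0. \<forall>n>0. norm (char_power_sum (\<lambda>P. ch (poly_value I m P)) n) \<le> C * sqrt (real CARD('p)) ^ n"
proof -
  let ?p = "CARD('p)" and ?U = "roots_of_unity d :: 'p mod_ring set"
  let ?f = "root_poly I m"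
  have finU: "finite ?U" using mu d card.infinite by fastforce
  have f0: "poly ?f 0 \<noteq> 0" using I0 by (auto simp: root_poly_def poly_prod)
  have ful: "d dvd j" if "\<forall>a. d dvd j * Polynomial.order a ?f" for j
    using that by (intro full) (metis order_root_poly finite)
  obtain C0 where C0: "C0 \<ge> 0" and bnd: "\<And>n c. n > 0 \<Longrightarrow> c ^ d = 1 \<Longrightarrow>
      real (card (power_class ?f d n c)) \<le> real ?p ^ n / d + C0 * sqrt (real ?p ^ n)"
    using card_power_class_bound[OF d mu dp f0 ful] by blast
  define C where "C = 2 * d * C0 + card I"
  have "norm (char_power_sum (\<lambda>P. ch (poly_value I m P)) n) \<le> C * sqrt (real ?p ^ n)" if n: "n > 0" for n
  proof -
    define A :: "'p mod_ring poly set" where "A = prime_polys_dvd n"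
    define v where "v = (\<lambda>P :: 'p mod_ring poly. poly_value I m P)"
    define E where "E = (?p - 1) div d"
    define cl where "cl = (\<lambda>P. v P ^ (n div degree P * E))"
    define W where "W = (\<lambda>c. \<Sum>P | P \<in> A \<and> cl P = c. degree P)"
    have E: "d * E = ?p - 1" "E > 0"
      using dp d prime_gt_1_nat[OF prime_card[where ?'a='p]] by (auto simp: E_def div_greater_zero_iff dest: dvd_imp_le)
    have finA: "finite A" unfolding A_def by (rule finite_prime_polys_dvd[OF n])
    have k0: "n div degree P > 0" if "P \<in> A" for P
      using that n prime_poly_degree_pos[of P]
      by (auto simp: A_def prime_polys_dvd_def div_greater_zero_iff dest: dvd_imp_le)
    have cl_in: "cl P \<in> ?U \<longleftrightarrow> v P \<noteq> 0" if "P \<in> A" for P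
    proof
      assume "v P \<noteq> 0"
      have "cl P ^ d = (v P ^ (?p - 1)) ^ (n div degree P)"
        unfolding cl_def by (simp only: power_mult[symmetric] E(1)[symmetric] mult_ac)
      then show "cl P \<in> ?U" using mod_ring_power_card_minus_one[OF \<open>v P \<noteq> 0\<close>] by (simp add: roots_of_unity_def)
    next
      assume "cl P \<in> ?U"
      then show "v P \<noteq> 0" using k0[OF that] E d by (auto simp: cl_def roots_of_unity_def zero_power)
    qed
    have chpow: "ch (x ^ k) = ch x ^ k" for x k by (induction k) (auto simp: mult one)
    have trm: "ch (v P) ^ (n div degree P) = (if cl P \<in> ?U then \<theta> (cl P) else 0)" if "P \<in> A" for P
    proof (cases "v P = 0")
      case False
      then show ?thesis
        using that cl_in[OF that] th[of "v P ^ (n div degree P)"]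
        by (simp add: cl_def E_def chpow power_mult)
    qed (use that k0 cl_in zero in \<open>auto simp: zero_power\<close>)
    have "char_power_sum (\<lambda>P. ch (poly_value I m P)) n = (\<Sum>P\<in>A. of_nat (degree P) * (if cl P \<in> ?U then \<theta> (cl P) else 0))"
      unfolding char_power_sum_def A_def[symmetric] v_def[symmetric]
      by (intro sum.cong refl) (simp add: trm)
    also have "\<dots> = (\<Sum>P | P \<in> A \<and> cl P \<in> ?U. of_nat (degree P) * \<theta> (cl P))"
      using finA by (simp add: sum.inter_filter[symmetric] if_distrib cong: if_cong)
    also have "\<dots> = (\<Sum>c\<in>?U. \<Sum>P | P \<in> {P. P \<in> A \<and> cl P \<in> ?U} \<and> cl P = c. of_nat (degree P) * \<theta> (cl P))"
      using finA finU by (intro sum.group[symmetric]) auto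
    also have "\<dots> = (\<Sum>c\<in>?U. of_nat (W c) * \<theta> c)"
      by (intro sum.cong refl) (auto simp: W_def sum_distrib_right intro!: sum.cong)
    also have "\<dots> = (\<Sum>c\<in>?U. (of_nat (W c) - of_real (real ?p ^ n / d)) * \<theta> c)"
    proof -
      have "(\<Sum>c\<in>?U. K * \<theta> c) = 0" for K by (simp add: thsum flip: sum_distrib_left)
      then show ?thesis by (simp only: left_diff_distrib sum_subtractf diff_0_right)
    qed
    finally have S: "char_power_sum (\<lambda>P. ch (poly_value I m P)) n = \<dots>" .
    \<comment> \<open>The upper bound in each class, and the total, which bounds the classes from below.\<close>
    have Wle: "real (W c) \<le> real ?p ^ n / d + C0 * sqrt (real ?p ^ n)" if "c \<in> ?U" for c
    proof -
      have "W c \<le> card (power_class ?f d n c)"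
        using sum_degree_le_card_power_class[OF n dp, of I m c]
        unfolding W_def A_def cl_def v_def E_def .
      then show ?thesis using bnd[OF n, of c] that by (simp add: roots_of_unity_def)
    qed
    have Wsum: "real ?p ^ n - card I \<le> (\<Sum>c\<in>?U. real (W c))"
    proof -
      have "?p ^ n = (\<Sum>P\<in>A. degree P)" unfolding A_def by (rule sum_degree_prime_polys_dvd[OF n, symmetric])
      also have "\<dots> = (\<Sum>P | P \<in> A \<and> cl P \<in> ?U. degree P) + (\<Sum>P | P \<in> A \<and> v P = 0. degree P)"
        using finA cl_in by (subst sum.union_disjoint[symmetric]) (auto intro!: sum.cong)
      also have "(\<Sum>P | P \<in> A \<and> cl P \<in> ?U. degree P) = (\<Sum>c\<in>?U. \<Sum>P | P \<in> {P. P \<in> A \<and> cl P \<in> ?U} \<and> cl P = c. degree P)"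
        using finA finU by (intro sum.group[symmetric]) auto
      also have "\<dots> = (\<Sum>c\<in>?U. W c)"
        by (intro sum.cong refl) (auto simp: W_def intro!: sum.cong)
      also have "(\<Sum>P | P \<in> A \<and> v P = 0. degree P) \<le> card I"
      proof -
        have "{P. P \<in> A \<and> v P = 0} \<subseteq> (\<lambda>a. [:-a, 1:]) ` I"
        proof
          fix P assume "P \<in> {P. P \<in> A \<and> v P = 0}"
          then have P: "prime P" "v P = 0" by (auto simp: A_def prime_polys_dvd_def)
          then obtain a where a: "a \<in> I" "poly P a = 0" by (auto simp: v_def poly_value_def)
          then have "[:-a, 1:] dvd P" by (simp add: poly_eq_0_iff_dvd)
          then obtain w where w: "P = [:-a, 1:] * w" by (elim dvdE)
          moreover have "\<not> is_unit [:-a, 1:]" by (simp add: is_unit_iff_degree)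
          ultimately have "is_unit w" using P(1) by (metis irreducibleD prime_elem_imp_irreducible prime_imp_prime_elem)
          then obtain b where b: "w = [:b:]" by (metis degree_eq_zeroE is_unit_iff_degree not_is_unit_0)
          have "b \<noteq> 0" using b w P(1) by auto
          then have "b = 1" using prime_poly_lead_coeff[OF P(1)] w b by simp
          then show "P \<in> (\<lambda>a. [:-a, 1:]) ` I" using w b a by auto
        qed
        then have "(\<Sum>P | P \<in> A \<and> v P = 0. degree P) \<le> (\<Sum>P\<in>(\<lambda>a. [:-a, 1:]) ` I. degree P)"
          by (intro sum_mono2) auto
        also have "\<dots> = card I" by (subst sum.reindex) (auto simp: inj_on_def)
        finally show ?thesis .
      qed
      finally have "?p ^ n \<le> (\<Sum>c\<in>?U. W c) + card I" by simp
      then have "real (?p ^ n) \<le> real ((\<Sum>c\<in>?U. W c) + card I)" by (simp only: of_nat_le_iff)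
      then show ?thesis by simp
    qed
    let ?b = "C0 * sqrt (real ?p ^ n)"
    have b0: "?b \<ge> 0" using C0 by simp
    have "norm (char_power_sum (\<lambda>P. ch (poly_value I m P)) n) \<le> (\<Sum>c\<in>?U. norm ((of_nat (W c) - of_real (real ?p ^ n / d)) * \<theta> c))"
      unfolding S by (rule norm_sum)
    also have "\<dots> \<le> (\<Sum>c\<in>?U. 2 * ?b + real ?p ^ n / d - real (W c))"
    proof (intro sum_mono)
      fix c assume c: "c \<in> ?U"
      have "norm (of_nat (W c) - complex_of_real (real ?p ^ n / d)) = \<bar>real (W c) - real ?p ^ n / d\<bar>"
        by (metis norm_of_real of_real_diff of_real_of_nat_eq)
      moreover have "\<bar>real (W c) - real ?p ^ n / d\<bar> \<le> 2 * ?b + real ?p ^ n / d - real (W c)"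
        using Wle[OF c] b0 by linarith
      ultimately show "norm ((of_nat (W c) - of_real (real ?p ^ n / d)) * \<theta> c) \<le> 2 * ?b + real ?p ^ n / d - real (W c)"
        using thnorm[OF c] mult_mono[of "norm (of_nat (W c) - complex_of_real (real ?p ^ n / d))" _ "norm (\<theta> c)" 1]
        by (simp add: norm_mult)
    qed
    also have "\<dots> = 2 * d * ?b + real ?p ^ n - (\<Sum>c\<in>?U. real (W c))"
      using d by (simp add: sum_subtractf sum.distrib mu algebra_simps)
    also have "\<dots> \<le> 2 * d * ?b + card I" using Wsum by simp
    also have "real (card I) \<le> card I * sqrt (real ?p ^ n)"
      using prime_ge_1_nat[OF prime_card[where ?'a='p]] by (simp add: mult_le_cancel_left1)
    finally show ?thesis by (simp add: C_def algebra_simps)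
  qed
  then show ?thesis using C0 by (intro exI[of _ C]) (auto simp: C_def real_sqrt_power)
qed

text \<open>
  The linear coefficient is minus the sum of the inverses of the roots.
\<close>
lemma norm_linear_coeff_le:
  fixes q :: "complex poly" and \<rho> :: real
  assumes "poly q 0 = 1" "\<And>z. poly q z = 0 \<Longrightarrow> 1 \<le> \<rho> * norm z" "\<rho> \<ge> 0"
  shows "norm (coeff q 1) \<le> degree q * \<rho>"
  using assms
proof (induction "degree q" arbitrary: q)
  case 0
  then show ?case by (simp add: coeff_eq_0)
next
  case (Suc n)
  then obtain z where z: "poly q z = 0" using alg_closed_imp_poly_has_root[of q] by auto
  then obtain w where w: "q = [:-z, 1:] * w" by (auto simp: poly_eq_0_iff_dvd elim: dvdE)
  have z0: "z \<noteq> 0" using z Suc.prems by auto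
  have "w \<noteq> 0" using w Suc.hyps by auto
  define w' where "w' = smult (-z) w"
  have deg: "degree w' = n" using w z0 Suc.hyps(2) \<open>w \<noteq> 0\<close> degree_mult_eq[of "[:-z,1:]" w] by (simp add: w'_def)
  have IH: "norm (coeff w' 1) \<le> n * \<rho>"
    using Suc.hyps(1)[of w'] deg Suc.prems w z0 by (auto simp: w'_def)
  have "coeff w 0 = - 1 / z" using Suc.prems(1) w z0 by (simp add: poly_0_coeff_0 field_simps) (metis add.inverse_inverse mult_minus_left)
  then have "coeff q 1 = - 1 / z + coeff w' 1" by (simp add: w w'_def)
  also have "norm \<dots> \<le> norm (- 1 / z) + norm (coeff w' 1)" by (rule norm_triangle_ineq)
  also have "norm (- 1 / z) \<le> \<rho>"
    using Suc.prems(2)[OF z] z0 by (simp add: norm_divide field_simps)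
  finally show ?case using IH Suc.hyps(2) by (simp add: algebra_simps flip: Suc.hyps(2))
qed

text \<open>
  The generating function G of the power sums converges for |z| < 1/\<rho> and satisfies
  q' = G q there. With a primitive H of G, the product q exp(-H) is constant, so q has no zero in
  this disc. The radius of convergence depends on \<rho> alone.
\<close>
lemma linear_coeff_of_power_sum_bound:
  fixes c S :: "nat \<Rightarrow> complex" and s :: nat and C \<rho> :: real
  assumes c0: "c 0 = 1" and c: "\<And>n. n > s \<Longrightarrow> c n = 0"
    and newton: "\<And>n. of_nat n * c n = (\<Sum>k=1..n. S k * c (n - k))"
    and S: "\<And>n. n > 0 \<Longrightarrow> norm (S n) \<le> C * \<rho> ^ n" and rho: "\<rho> > 0"
  shows "norm (c 1) \<le> s * \<rho>"
proof -
  define q where "q = (\<Sum>n\<le>s. Polynomial.monom (c n) n)"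
  have cq: "coeff q n = c n" for n
    using c[of n] by (auto simp: q_def coeff_sum not_le)
  define L where "L = fps_of_poly q"
  define G where "G = Abs_fps (\<lambda>n. S (Suc n))"
  have LG: "fps_deriv L = G * L"
  proof (rule fps_ext)
    fix n
    have "fps_nth (fps_deriv L) n = of_nat (Suc n) * c (Suc n)" by (simp add: L_def cq)
    also have "\<dots> = (\<Sum>k=1..Suc n. S k * c (Suc n - k))" by (rule newton)
    also have "\<dots> = (\<Sum>k=0..n. S (Suc k) * c (n - k))"
      by (simp only: One_nat_def sum.shift_bounds_cl_Suc_ivl diff_Suc_Suc)
    also have "\<dots> = fps_nth (G * L) n" by (simp add: fps_mult_nth G_def L_def cq)
    finally show "fps_nth (fps_deriv L) n = fps_nth (G * L) n" .
  qed
  have rad: "fps_conv_radius G \<ge> 1 / \<rho>"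
    unfolding fps_conv_radius_def
  proof (rule conv_radius_geI_ex')
    fix r assume r: "0 < r" "ereal r < ereal (1 / \<rho>)"
    show "summable (\<lambda>n. fps_nth G n * of_real r ^ n)"
    proof (rule summable_comparison_test)
      show "\<exists>N. \<forall>n\<ge>N. norm (fps_nth G n * of_real r ^ n) \<le> C * \<rho> * (\<rho> * r) ^ n"
      proof (intro exI[of _ 0] allI impI)
        fix n
        have "norm (fps_nth G n * of_real r ^ n) \<le> (C * \<rho> ^ Suc n) * r ^ n"
          using S[of "Suc n"] r by (simp add: G_def norm_mult norm_power mult_right_mono)
        then show "norm (fps_nth G n * of_real r ^ n) \<le> C * \<rho> * (\<rho> * r) ^ n"
          by (simp add: power_mult_distrib mult_ac)
      qed
      have "\<rho> * r < 1" using r rho by (simp add: field_simps)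
      then show "summable (\<lambda>n. C * \<rho> * (\<rho> * r) ^ n)"
        using r rho by (intro summable_mult summable_geometric) auto
    qed
  qed
  have Linf: "fps_conv_radius L = \<infinity>" unfolding L_def by simp
  define B where "B = ball (0::complex) (1 / \<rho>)"
  have inB: "ereal (norm z) < fps_conv_radius G" if "z \<in> B" for z
    using that rad by (auto simp: B_def intro: less_le_trans[OF _ rad])
  have evL: "eval_fps L z = poly q z" for z by (simp add: L_def)
  have der: "poly (pderiv q) z = eval_fps G z * poly q z" if "z \<in> B" for z
  proof -
    have "poly (pderiv q) z = eval_fps (fps_deriv L) z"
      by (simp add: L_def flip: fps_of_poly_pderiv)
    also have "\<dots> = eval_fps G z * eval_fps L z"
      unfolding LG using inB[OF that] Linf by (intro eval_fps_mult) auto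
    finally show ?thesis by (simp add: evL)
  qed
  have "eval_fps G holomorphic_on B"
    using inB by (intro holomorphic_intros) (auto simp: eball_def in_eball_iff dist_norm)
  then obtain H where H: "\<And>z. z \<in> B \<Longrightarrow> (H has_field_derivative eval_fps G z) (at z within B)"
    using holomorphic_convex_primitive'[of B "eval_fps G"] unfolding B_def by (auto simp: convex_ball)
  have "poly q z \<noteq> 0" if z: "z \<in> B" for z
  proof -
    have "\<exists>k. \<forall>z\<in>B. poly q z * exp (- H z) = k"
    proof (rule has_field_derivative_zero_constant)
      show "convex B" by (simp add: B_def)
      fix z assume z: "z \<in> B"
      show "((\<lambda>z. poly q z * exp (- H z)) has_field_derivative 0) (at z within B)"
        by (rule derivative_eq_intros poly_DERIV[THEN has_field_derivative_at_within] H z refl)+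
           (simp add: der[OF z] algebra_simps)
    qed
    then obtain k where k: "\<And>z. z \<in> B \<Longrightarrow> poly q z * exp (- H z) = k" by blast
    have "0 \<in> B" using rho by (simp add: B_def)
    then have "k \<noteq> 0" using k[of 0] c0 by (auto simp: poly_0_coeff_0 cq)
    then show ?thesis using k[OF z] by auto
  qed
  then have "1 \<le> \<rho> * norm z" if "poly q z = 0" for z
    using that rho by (force simp: B_def field_simps not_less)
  then have "norm (coeff q 1) \<le> degree q * \<rho>"
    using rho c0 by (intro norm_linear_coeff_le) (auto simp: poly_0_coeff_0 cq)
  also have "degree q \<le> s" by (rule degree_le) (use c cq in auto)
  then have "degree q * \<rho> \<le> s * \<rho>" using rho by (intro mult_right_mono) auto
  finally show ?thesis by (simp add: cq)
qed


section \<open>Weil's bound\<close>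

text \<open>
  The polynomial g vanishes at all points but a and has degree below n. Adding multiples of g
  permutes the monic polynomials of degree n, leaves the values at the other points unchanged,
  and moves the value at a through all of the field.
\<close>
lemma char_coeff_eq_0:
  fixes I :: "'p::prime_card mod_ring set" and ch :: "'p mod_ring \<Rightarrow> complex"
  assumes a: "a \<in> I" and sum0: "(\<Sum>v\<in>UNIV. ch (v ^ m a)) = 0"
    and mult: "\<And>x y. ch (x * y) = ch x * ch y" and n: "card I \<le> n"
  shows "char_coeff (\<lambda>P. ch (poly_value I m P)) n = 0"
proof -
  let ?h = "\<lambda>P. ch (poly_value I m P)"
  define g where "g = (\<Prod>b\<in>I - {a}. [:-b, 1:])"
  have fin: "finite I" by simp
  have ga: "poly g a \<noteq> 0" by (auto simp: g_def poly_prod)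
  have gb: "poly g b = 0" if "b \<in> I - {a}" for b using that by (auto simp: g_def poly_prod)
  have "degree g = card I - 1" using a by (simp add: g_def degree_prod_eq_sum_degree)
  moreover have "card I > 0" using a fin by (auto simp: card_gt_0_iff)
  ultimately have dg: "degree g < n" using n by linarith
  have shift: "P + smult v g \<in> monics n" if "P \<in> monics n" for P v
  proof -
    have P: "degree P = n" "coeff P n = 1" using that by (auto simp: monics_def)
    have "degree (smult v g) < degree P" using P dg degree_smult_le[of v g] by linarith
    then have "degree (P + smult v g) = n" using P by (simp add: degree_add_eq_left)
    moreover have "coeff (P + smult v g) n = 1" using P coeff_eq_0[OF dg] by simp
    ultimately show ?thesis by (simp add: monics_def)
  qed
  have h: "?h (P + smult v g) = ch ((poly P a + v * poly g a) ^ m a) * ch (\<Prod>b\<in>I - {a}. poly P b ^ m b)" for P v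
  proof -
    have "poly_value I m (P + smult v g) =
          poly (P + smult v g) a ^ m a * (\<Prod>b\<in>I - {a}. poly (P + smult v g) b ^ m b)"
      unfolding poly_value_def using fin a by (rule prod.remove)
    also have "(\<Prod>b\<in>I - {a}. poly (P + smult v g) b ^ m b) = (\<Prod>b\<in>I - {a}. poly P b ^ m b)"
      by (intro prod.cong refl) (simp add: gb)
    finally show ?thesis by (simp add: mult)
  qed
  have inner: "(\<Sum>v\<in>UNIV. ch ((c + v * poly g a) ^ m a)) = 0" for c
  proof -
    have "(\<Sum>v\<in>UNIV. ch ((c + v * poly g a) ^ m a)) = (\<Sum>v\<in>UNIV. ch (v ^ m a))"
      by (rule sum.reindex_bij_witness[of _ "\<lambda>v. (v - c) / poly g a" "\<lambda>v. c + v * poly g a"])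
         (use ga in auto)
    then show ?thesis by (simp add: sum0)
  qed
  have "of_nat CARD('p) * char_coeff ?h n = (\<Sum>v\<in>(UNIV :: 'p mod_ring set). \<Sum>P\<in>monics n. ?h P)"
    by (simp add: char_coeff_def)
  also have "\<dots> = (\<Sum>v\<in>UNIV. \<Sum>P\<in>monics n. ?h (P + smult v g))"
  proof (rule sum.cong[OF refl])
    fix v
    have "bij_betw (\<lambda>P. P + smult v g) (monics n) (monics n)"
    proof (rule bij_betwI[of _ _ _ "\<lambda>P. P + smult (-v) g"])
      show "(\<lambda>P. P + smult (-v) g) \<in> monics n \<rightarrow> monics n" by (intro Pi_I shift)
      show "(\<lambda>P. P + smult v g) \<in> monics n \<rightarrow> monics n" by (intro Pi_I shift)
    qed simp_all
    then show "(\<Sum>P\<in>monics n. ?h P) = (\<Sum>P\<in>monics n. ?h (P + smult v g))"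
      by (rule sum.reindex_bij_betw[symmetric])
  qed
  also have "\<dots> = (\<Sum>P\<in>monics n. \<Sum>v\<in>UNIV. ?h (P + smult v g))" by (rule sum.swap)
  also have "\<dots> = 0" by (simp only: h sum_distrib_right[symmetric] inner) simp
  finally show ?thesis by simp
qed

lemma weil_bound_aux:
  fixes I :: "'p::prime_card mod_ring set" and ch \<theta> :: "'p mod_ring \<Rightarrow> complex"
  assumes d: "d > 0" and mu: "card (roots_of_unity d :: 'p mod_ring set) = d"
    and dp: "d dvd CARD('p) - 1"
    and I0: "0 \<notin> I"
    and full: "\<And>j. (\<forall>a\<in>I. d dvd j * m a) \<Longrightarrow> d dvd j"
    and mult: "\<And>x y. ch (x * y) = ch x * ch y" and one: "ch 1 = 1" and zero: "ch 0 = 0"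
    and th: "\<And>x. x \<noteq> 0 \<Longrightarrow> ch x = \<theta> (x ^ ((CARD('p) - 1) div d))"
    and thsum: "(\<Sum>c\<in>roots_of_unity d. \<theta> c) = 0"
    and thnorm: "\<And>c. c \<in> roots_of_unity d \<Longrightarrow> norm (\<theta> c) \<le> 1"
    and a: "a \<in> I" and sum0: "(\<Sum>v\<in>UNIV. ch (v ^ m a)) = 0"
  shows "norm (\<Sum>x\<in>UNIV. ch (\<Prod>a\<in>I. (a - x) ^ m a)) \<le> real (card I - 1) * sqrt (real CARD('p))"
proof -
  let ?h = "\<lambda>P. ch (poly_value I m P)"
  have "\<exists>C\<ge>0. \<forall>n>0. norm (char_power_sum ?h n) \<le> C * sqrt (real CARD('p)) ^ n"
    by (rule char_power_sum_bound[OF d mu dp I0 full mult one zero th thsum thnorm])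
  then obtain C where C: "\<forall>n>0. norm (char_power_sum ?h n) \<le> C * sqrt (real CARD('p)) ^ n"
    by (elim exE conjE) (rule that)
  have hm: "?h (f * g) = ?h f * ?h g" for f g
    by (simp add: poly_value_def power_mult_distrib prod.distrib mult)
  have h1: "?h 1 = 1" by (simp add: poly_value_def one)
  have c0: "char_coeff ?h 0 = 1" by (simp add: char_coeff_def monics_0 h1)
  have cI: "card I > 0" using a by (auto simp: card_gt_0_iff)
  have "char_coeff ?h 1 = (\<Sum>x\<in>UNIV. ?h [:x, 1:])"
  proof -
    have "monics (Suc 0) = (\<lambda>x :: 'p mod_ring. [:x, 1:]) ` UNIV"
      by (auto simp: monics_Suc monics_0)
    then show ?thesis unfolding char_coeff_def One_nat_def
      by (simp add: sum.reindex inj_on_def)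
  qed
  also have "\<dots> = (\<Sum>x\<in>UNIV. ?h [:-x, 1:])"
    by (rule sum.reindex_bij_witness[of _ uminus uminus]) auto
  also have "\<dots> = (\<Sum>x\<in>UNIV. ch (\<Prod>a\<in>I. (a - x) ^ m a))"
    by (simp add: poly_value_def)
  finally have c1: "char_coeff ?h 1 = (\<Sum>x\<in>UNIV. ch (\<Prod>a\<in>I. (a - x) ^ m a))" .
  show ?thesis
    unfolding c1[symmetric]
  proof (rule linear_coeff_of_power_sum_bound[where c = "char_coeff ?h" and S = "char_power_sum ?h" and C = C, OF c0])
    show "of_nat n * char_coeff ?h n = (\<Sum>k=1..n. char_power_sum ?h k * char_coeff ?h (n - k))" for n
      by (rule newton_identity[where h = ?h, OF hm h1])
    show "norm (char_power_sum ?h n) \<le> C * sqrt (real CARD('p)) ^ n" if "n > 0" for n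
      using that C by simp
    show "char_coeff ?h n = 0" if "n > card I - 1" for n
      using that by (intro char_coeff_eq_0[where ch = ch and m = m and a = a] a sum0 mult) linarith
    show "sqrt (real CARD('p)) > 0"
      using prime_gt_0_nat[OF prime_card[where ?'a='p]] by simp
  qed
qed


section \<open>The characters of the multiplicative group\<close>

lemma sum_eq_0_by_scaling:
  fixes F :: "'a \<Rightarrow> complex"
  assumes "bij_betw t A A" "\<And>x. x \<in> A \<Longrightarrow> F (t x) = z * F x" "z \<noteq> 1"
  shows "sum F A = 0"
proof -
  have "sum F A = (\<Sum>x\<in>A. F (t x))" using sum.reindex_bij_betw[OF assms(1), of F] by simp
  also have "\<dots> = z * sum F A" by (simp add: assms(2) sum_distrib_left)
  finally have "(1 - z) * sum F A = 0" by (simp add: algebra_simps)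
  then show ?thesis using assms(3) by simp
qed

lemma cis_eq_1_iff_dvd:
  assumes "N > 0"
  shows "cis (2 * pi * real k / real N) = 1 \<longleftrightarrow> N dvd k"
proof -
  have "cis (2 * pi * real k / real N) = exp (2 * of_real pi * \<i> * of_nat k / of_nat N)"
    by (simp add: cis_conv_exp mult_ac)
  then show ?thesis using complex_root_unity_eq_1[of N k] assms by simp
qed

text \<open>
  The character \<omega> generates the group of multiplicative characters.
\<close>
locale generating_character =
  fixes \<gamma> :: "'p::prime_card mod_ring" and \<omega> :: "'p mod_ring \<Rightarrow> complex" and N :: nat
  assumes N_eq: "N = CARD('p) - 1"
    and generator: "\<And>x. x \<noteq> 0 \<Longrightarrow> \<exists>k. x = \<gamma> ^ k"
    and power_eq_iff: "\<And>i j. \<gamma> ^ i = \<gamma> ^ j \<longleftrightarrow> [i = j] (mod N)"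
    and omega_power: "\<And>k. \<omega> (\<gamma> ^ k) = cis (2 * pi * real k / real N)"
    and omega_0: "\<omega> 0 = 0"
begin

lemma N_pos: "N > 0"
  using prime_gt_1_nat[OF prime_card[where ?'a='p]] by (simp add: N_eq)

lemma gamma_nz: "\<gamma> \<noteq> 0"
proof -
  have "\<gamma> ^ N = \<gamma> ^ 0" by (subst power_eq_iff) (simp add: cong_0_iff)
  then show ?thesis using N_pos by (metis power_0 zero_neq_one zero_power)
qed

lemma omega_1: "\<omega> 1 = 1" using omega_power[of 0] by simp

lemma omega_mult: "\<omega> (x * y) = \<omega> x * \<omega> y"
proof (cases "x = 0 \<or> y = 0")
  case False
  then obtain i j where "x = \<gamma> ^ i" "y = \<gamma> ^ j" using generator by metis
  then show ?thesis
    by (simp add: omega_power cis_mult add_divide_distrib distrib_left flip: power_add)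
qed (auto simp: omega_0)

lemma omega_pow: "\<omega> (x ^ n) = \<omega> x ^ n"
  by (induction n) (simp_all add: omega_1 omega_mult)

lemma omega_prod: "\<omega> (\<Prod>a\<in>A. f a) = (\<Prod>a\<in>A. \<omega> (f a))"
  by (induction A rule: infinite_finite_induct) (simp_all add: omega_1 omega_mult)

lemma norm_omega: "x \<noteq> 0 \<Longrightarrow> norm (\<omega> x) = 1"
  using generator[of x] by (auto simp: omega_power)

lemma norm_omega_le: "norm (\<omega> x) \<le> 1"
  by (cases "x = 0") (simp_all add: omega_0 norm_omega)

lemma omega_gamma_pow: "\<omega> \<gamma> ^ k = 1 \<longleftrightarrow> N dvd k"
  using cis_eq_1_iff_dvd[OF N_pos, of k] omega_power[of k] by (simp add: omega_pow)

lemma sum_omega_pow: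
  assumes "\<not> N dvd k"
  shows "(\<Sum>v\<in>UNIV. \<omega> v ^ k) = 0"
proof (rule sum_eq_0_by_scaling)
  show "bij_betw ((*) \<gamma>) UNIV UNIV"
    by (rule bij_betwI[of _ _ _ "\<lambda>x. x / \<gamma>"]) (auto simp: gamma_nz)
  show "\<omega> (\<gamma> * x) ^ k = \<omega> \<gamma> ^ k * \<omega> x ^ k" for x by (simp add: omega_mult power_mult_distrib)
  show "\<omega> \<gamma> ^ k \<noteq> 1" using assms by (simp add: omega_gamma_pow)
qed

lemma roots_of_unity_eq:
  assumes "N = d * g"
  shows "roots_of_unity d = (\<lambda>j. \<gamma> ^ (g * j)) ` {..<d}"
    and "inj_on (\<lambda>j. \<gamma> ^ (g * j)) {..<d}"
proof -
  have dg: "d > 0" "g > 0" using assms N_pos by (auto intro: Nat.gr0I)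
  have "\<gamma> ^ N = 1" using power_eq_iff[of N 0] by (simp add: cong_0_iff)
  then have "(\<gamma> ^ (g * j)) ^ d = 1" for j
  proof -
    have "(\<gamma> ^ (g * j)) ^ d = (\<gamma> ^ N) ^ j" by (simp add: assms mult_ac flip: power_mult)
    then show ?thesis using \<open>\<gamma> ^ N = 1\<close> by simp
  qed
  moreover have "x \<in> (\<lambda>j. \<gamma> ^ (g * j)) ` {..<d}" if x: "x ^ d = 1" for x
  proof -
    have "x \<noteq> 0" using x dg by (auto simp: zero_power)
    then obtain k where k: "x = \<gamma> ^ k" using generator by blast
    have "\<gamma> ^ (k * d) = \<gamma> ^ 0" using x k by (simp add: power_mult)
    then have "N dvd k * d" unfolding power_eq_iff by (simp add: cong_0_iff)
    then have "g dvd k" using dg by (simp add: assms mult.commute)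
    then obtain j where j: "k = g * j" by auto
    have "[k = g * (j mod d)] (mod N)"
      unfolding assms j mult.commute[of d g] mult_mod_right by (simp only: cong_mod_right cong_refl)
    then have "x = \<gamma> ^ (g * (j mod d))" unfolding k power_eq_iff .
    then show ?thesis using dg by auto
  qed
  ultimately show "roots_of_unity d = (\<lambda>j. \<gamma> ^ (g * j)) ` {..<d}"
    by (auto simp: roots_of_unity_def)
  show "inj_on (\<lambda>j. \<gamma> ^ (g * j)) {..<d}"
  proof (rule inj_onI)
    fix i j assume ij: "i \<in> {..<d}" "j \<in> {..<d}" "\<gamma> ^ (g * i) = \<gamma> ^ (g * j)"
    then have "[g * i = g * j] (mod d * g)" by (simp only: power_eq_iff assms)
    then have "g * i = g * j" using ij dg by (intro cong_less_modulus_unique_nat) auto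
    then show "i = j" using dg by simp
  qed
qed

text \<open>
  The characters \<omega>^(k a) need not be powers of each other, and none of them need have
  the order d of the group which they generate together. With g the greatest common divisor of N
  and the k a, all of them are powers of \<omega>^g, which has order d = N/g, and the exponents
  m a = k a / g have no common factor with d. This is the hypothesis of Kummer theory.
\<close>
lemma weil_bound_nonzero:
  assumes I0: "0 \<notin> I" and a: "a \<in> I" and k: "\<And>a. a \<in> I \<Longrightarrow> \<not> N dvd k a"
  shows "norm (\<Sum>x\<in>UNIV. \<Prod>a\<in>I. \<omega> (a - x) ^ k a) \<le> real (card I - 1) * sqrt (real CARD('p))"
proof -
  define g where "g = gcd N (Gcd (k ` I))"
  define d where "d = N div g"
  define m where "m = (\<lambda>a. k a div g)"
  define ch where "ch = (\<lambda>x. \<omega> x ^ g)"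
  have gN: "g dvd N" by (simp add: g_def)
  have g0: "g > 0" using gN N_pos by (metis dvd_0_left_iff neq0_conv)
  have N: "N = d * g" using gN by (simp add: d_def)
  have d0: "d > 0" using N N_pos by (auto intro: Nat.gr0I)
  have gk: "k a = m a * g" if "a \<in> I" for a
  proof -
    have "Gcd (k ` I) dvd k a" using that by (intro Gcd_dvd) auto
    then have "g dvd k a" unfolding g_def by (meson dvd_trans gcd_dvd2)
    then show ?thesis by (simp add: m_def)
  qed
  have Ndg: "N div d = g" using N d0 by simp
  have chpow: "ch (x ^ n) = \<omega> x ^ (n * g)" for x n
    by (simp add: ch_def omega_pow power_mult)
  have eq: "(\<Prod>a\<in>I. \<omega> (a - x) ^ k a) = ch (\<Prod>a\<in>I. (a - x) ^ m a)" for x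
    by (simp add: ch_def omega_prod omega_pow gk prod_power_distrib power_mult)
  show ?thesis
    unfolding eq
  proof (rule weil_bound_aux[where d = d and \<theta> = \<omega> and m = m and a = a])
    show "d > 0" by fact
    show "card (roots_of_unity d :: 'p mod_ring set) = d"
      using roots_of_unity_eq[OF N] by (simp add: card_image)
    show "d dvd CARD('p) - 1" unfolding N_eq[symmetric] by (simp add: N)
    show "0 \<notin> I" "a \<in> I" by fact+
    show "d dvd j" if j: "\<forall>a\<in>I. d dvd j * m a" for j
    proof -
      have "N dvd j * k a" if "a \<in> I" for a
        using j that gk[OF that] by (simp add: N mult.assoc[symmetric])
      then have "N dvd Gcd ((*) j ` k ` I)" by (intro Gcd_greatest) auto
      then have "N dvd j * Gcd (k ` I)" by (simp add: Gcd_mult)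
      moreover have "N dvd j * N" by simp
      ultimately have "N dvd gcd (j * N) (j * Gcd (k ` I))" by simp
      also have "gcd (j * N) (j * Gcd (k ` I)) = j * g"
        unfolding g_def by (rule gcd_mult_distrib_nat[symmetric])
      finally have "d * g dvd j * g" by (simp only: N)
      then show "d dvd j" using g0 by simp
    qed
    show "ch (x * y) = ch x * ch y" for x y by (simp add: ch_def omega_mult power_mult_distrib)
    show "ch 1 = 1" by (simp add: ch_def omega_1)
    show "ch 0 = 0" using g0 by (simp add: ch_def omega_0)
    show "ch x = \<omega> (x ^ ((CARD('p) - 1) div d))" if "x \<noteq> 0" for x unfolding N_eq[symmetric] Ndg by (simp add: ch_def omega_pow)
    show "norm (\<omega> c) \<le> 1" for c by (rule norm_omega_le)
    show "(\<Sum>v\<in>UNIV. ch (v ^ m a)) = 0"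
      using sum_omega_pow[OF k[OF a]] by (simp add: chpow gk[OF a])
    show "(\<Sum>c\<in>roots_of_unity d. \<omega> c) = 0"
    proof (rule sum_eq_0_by_scaling)
      let ?c = "\<gamma> ^ g"
      have c: "?c ^ d = 1" using power_eq_iff[of N 0] N by (simp add: cong_0_iff mult.commute flip: power_mult)
      show "bij_betw ((*) ?c) (roots_of_unity d) (roots_of_unity d)"
        using gamma_nz c by (intro bij_betwI[of _ _ _ "\<lambda>x. x / ?c"])
          (auto simp: roots_of_unity_def power_mult_distrib power_divide)
      show "\<omega> (?c * x) = \<omega> \<gamma> ^ g * \<omega> x" for x by (simp add: omega_mult omega_pow)
      show "\<omega> \<gamma> ^ g \<noteq> 1"
      proof
        assume "\<omega> \<gamma> ^ g = 1"
        then have "N dvd g" by (simp add: omega_gamma_pow)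
        then have "N dvd k a" using gk[OF a] by simp
        then show False using k[OF a] by simp
      qed
    qed
  qed
qed

text \<open>
  A translation moves a point outside I to the origin, the place at which Stepanov's auxiliary
  polynomial is expanded.
\<close>
theorem weil_bound:
  assumes I: "I \<noteq> UNIV" and a: "a \<in> I" and k: "\<And>a. a \<in> I \<Longrightarrow> \<not> N dvd k a"
  shows "norm (\<Sum>x\<in>UNIV. \<Prod>a\<in>I. \<omega> (a - x) ^ k a) \<le> real (card I - 1) * sqrt (real CARD('p))"
proof -
  obtain b where b: "b \<notin> I" using I by auto
  let ?J = "(\<lambda>a. a - b) ` I"
  have inj: "inj_on (\<lambda>a. a - b) I" by (auto simp: inj_on_def)
  have "(\<Sum>x\<in>UNIV. \<Prod>a\<in>I. \<omega> (a - x) ^ k a) = (\<Sum>x\<in>UNIV. \<Prod>a\<in>I. \<omega> (a - b - x) ^ k a)"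
    by (rule sum.reindex_bij_witness[of _ "\<lambda>x. x + b" "\<lambda>x. x - b"]) (auto simp: algebra_simps)
  also have "\<dots> = (\<Sum>x\<in>UNIV. \<Prod>a\<in>?J. \<omega> (a - x) ^ k (a + b))"
    by (simp add: prod.reindex[OF inj])
  finally have "norm (\<Sum>x\<in>UNIV. \<Prod>a\<in>I. \<omega> (a - x) ^ k a) = norm \<dots>" by simp
  also have "\<dots> \<le> real (card ?J - 1) * sqrt (real CARD('p))"
    using a b k by (intro weil_bound_nonzero[of _ "a - b"]) auto
  also have "card ?J = card I" by (rule card_image[OF inj])
  finally show ?thesis .
qed

end

lemma exists_generating_character:
  assumes g: "residue_primroot CARD('p::prime_card) g"
  shows "\<exists>\<omega>. generating_character (of_nat g :: 'p mod_ring) \<omega> (CARD('p) - 1)"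
proof -
  let ?p = "CARD('p)" and ?g = "of_nat g :: 'p mod_ring"
  have p: "prime ?p" by (rule prime_card)
  have tot: "totient ?p = ?p - 1" by (rule totient_prime[OF p])
  have ord: "ord ?p g = ?p - 1" and cop: "coprime ?p g"
    using g by (auto simp: residue_primroot_def tot)
  have eqc: "(of_nat a :: 'p mod_ring) = of_nat b \<longleftrightarrow> [a = b] (mod ?p)" for a b
    by (simp add: of_nat_eq_iff_cong_CHAR)
  have peq: "?g ^ i = ?g ^ j \<longleftrightarrow> [i = j] (mod ?p - 1)" for i j
    using order_divides_expdiff[OF cop, of i j] eqc[of "g ^ i" "g ^ j"] by (simp add: ord)
  have gen: "\<exists>k. x = ?g ^ k" if x: "x \<noteq> 0" for x :: "'p mod_ring"
  proof -
    obtain i where i: "i < ?p" "x = of_nat i" using surj_of_nat_mod_ring by blast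
    have "i \<noteq> 0" using x i by (metis of_nat_0)
    then have "i \<in> totatives ?p" using i p by (simp add: totatives_prime)
    then obtain k where "i = g ^ k mod ?p"
      using residue_primroot_is_generator[OF prime_gt_1_nat[OF p] g] by (auto simp: bij_betw_def)
    then have "[i = g ^ k] (mod ?p)" by simp
    then have "x = ?g ^ k" using eqc[of i "g ^ k"] i by simp
    then show ?thesis ..
  qed
  define \<omega> where "\<omega> = (\<lambda>x. if x = 0 then 0 else cis (2 * pi * real (SOME k. x = ?g ^ k) / real (?p - 1)))"
  have "?g \<noteq> 0"
  proof
    assume "?g = 0"
    then have "of_nat g = (of_nat 0 :: 'p mod_ring)" by simp
    then have "?p dvd g" unfolding eqc by (simp add: cong_0_iff)
    then show False using cop p by (metis coprime_absorb_left not_prime_unit)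
  qed
  have "\<omega> (?g ^ k) = cis (2 * pi * real k / real (?p - 1))" for k
  proof -
    define i where "i = (SOME i. ?g ^ k = ?g ^ i)"
    have "?g ^ k = ?g ^ i" unfolding i_def by (rule someI) (rule refl)
    then have "[i = k] (mod ?p - 1)" using peq by (metis cong_sym)
    then have "[int i = int k] (mod int (?p - 1))" by (simp only: cong_int_iff)
    then obtain z where z: "int k = int i + int (?p - 1) * z" unfolding cong_iff_lin by blast
    have N0: "real (?p - 1) \<noteq> 0" using prime_gt_1_nat[OF p] by simp
    have "real k = real_of_int (int k)" by simp
    also have "\<dots> = real i + real (?p - 1) * of_int z" unfolding z by simp
    finally have kz: "real k = real i + real (?p - 1) * of_int z" .
    have "2 * pi * real k / real (?p - 1) = 2 * pi * real i / real (?p - 1) + 2 * pi * of_int z"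
      unfolding kz distrib_left add_divide_distrib using N0 by simp
    then have "cis (2 * pi * real k / real (?p - 1)) = cis (2 * pi * real i / real (?p - 1)) * cis (2 * pi * of_int z)"
      by (simp only: cis_mult)
    also have "cis (2 * pi * of_int z) = 1" by (rule cis_multiple_2pi) simp
    finally show ?thesis using \<open>?g \<noteq> 0\<close> by (simp add: \<omega>_def i_def)
  qed
  then have "generating_character ?g \<omega> (?p - 1)"
    by unfold_locales (auto simp: gen peq \<omega>_def)
  then show ?thesis by (intro exI[of _ \<omega>])
qed


section \<open>Counting simultaneously primitive elements\<close>

lemma prod_primes_dvd_iff:
  fixes k :: nat
  assumes "finite T" "\<And>l. l \<in> T \<Longrightarrow> prime l"
  shows "\<Prod>T dvd k \<longleftrightarrow> (\<forall>l\<in>T. l dvd k)"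
  using assms
proof (induction T rule: finite_induct)
  case (insert x T)
  have "coprime x (\<Prod>T)"
    using insert by (intro prod_coprime_right) (auto intro!: primes_coprime)
  then have "x * \<Prod>T dvd k \<longleftrightarrow> x dvd k \<and> \<Prod>T dvd k"
    by (metis divides_mult dvd_mult_left dvd_mult_right)
  then show ?case using insert by simp
qed simp

text \<open>
  The pair (T, j) stands for the character of exponent j N / D, where D is the product of the
  set T of primes dividing N. For fixed T these are the characters that are trivial on the
  D-th powers.
\<close>
definition sieve_index :: "nat \<Rightarrow> (nat set \<times> nat) set" where
  "sieve_index N = (SIGMA T:Pow (prime_factors N). {..<\<Prod>T})"

definition sieve_weight :: "nat set \<times> nat \<Rightarrow> complex" where
  "sieve_weight = (\<lambda>(T, j). (-1) ^ card T / of_nat (\<Prod>T))"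

definition sieve_exponent :: "nat \<Rightarrow> nat set \<times> nat \<Rightarrow> nat" where
  "sieve_exponent N = (\<lambda>(T, j). j * (N div \<Prod>T))"

lemma sieve_modulus:
  fixes N :: nat
  assumes "N > 0" "T \<subseteq> prime_factors N"
  shows "\<Prod>T dvd N" "\<Prod>T > 0"
proof -
  have fin: "finite T" using assms(2) by (rule finite_subset) auto
  have "\<And>l. l \<in> T \<Longrightarrow> prime l \<and> l dvd N" using assms(2) by (auto dest: in_prime_factors_imp_prime)
  then show "\<Prod>T dvd N" using prod_primes_dvd_iff[OF fin, of N] by auto
  then show "\<Prod>T > 0" using assms(1) by (metis dvd_0_left_iff neq0_conv)
qed

lemma finite_sieve_index: "finite (sieve_index N)"
  by (auto simp: sieve_index_def intro!: finite_SigmaI)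

lemma sum_norm_sieve_weight:
  assumes "N > 0"
  shows "(\<Sum>t\<in>sieve_index N. norm (sieve_weight t)) = 2 ^ card (prime_factors N)"
proof -
  have "(\<Sum>t\<in>sieve_index N. norm (sieve_weight t)) =
        (\<Sum>T\<in>Pow (prime_factors N). \<Sum>j<\<Prod>T. norm (sieve_weight (T, j)))"
    unfolding sieve_index_def by (subst sum.Sigma) auto
  also have "\<dots> = (\<Sum>T\<in>Pow (prime_factors N). 1)"
  proof (intro sum.cong refl)
    fix T assume "T \<in> Pow (prime_factors N)"
    then have "\<Prod>T > 0" using sieve_modulus(2)[OF assms] by blast
    then have "real (\<Prod>T) \<noteq> 0" by (simp del: of_nat_prod)
    then show "(\<Sum>j<\<Prod>T. norm (sieve_weight (T, j))) = 1"
      by (simp add: sieve_weight_def norm_divide norm_power del: of_nat_prod)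
  qed
  finally show ?thesis by (simp add: card_Pow)
qed

text \<open>
  The trivial characters are those with j = 0, so this is Euler's product for the totient.
\<close>
lemma sum_trivial_sieve_weight:
  assumes "N > 0"
  shows "(\<Sum>t | t \<in> sieve_index N \<and> N dvd sieve_exponent N t. sieve_weight t) = of_real (totient N / N)"
proof -
  have "N dvd sieve_exponent N (T, j) \<longleftrightarrow> j = 0" if "(T, j) \<in> sieve_index N" for T j
  proof -
    have T: "T \<subseteq> prime_factors N" "j < \<Prod>T" using that by (auto simp: sieve_index_def)
    obtain c where c: "N = \<Prod>T * c" using sieve_modulus[OF assms T(1)] by auto
    then have "N div \<Prod>T = c" "c > 0" using sieve_modulus[OF assms T(1)] assms by (auto intro: Nat.gr0I)
    then have "N dvd j * (N div \<Prod>T) \<longleftrightarrow> \<Prod>T dvd j" using c by simp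
    then show ?thesis using T(2) by (auto simp: sieve_exponent_def dest: dvd_imp_le)
  qed
  then have "{t. t \<in> sieve_index N \<and> N dvd sieve_exponent N t} = (\<lambda>T. (T, 0)) ` Pow (prime_factors N)"
    using sieve_modulus(2)[OF assms] by (fastforce simp: sieve_index_def image_iff)
  then have "(\<Sum>t | t \<in> sieve_index N \<and> N dvd sieve_exponent N t. sieve_weight t) =
             (\<Sum>T\<in>Pow (prime_factors N). sieve_weight (T, 0))"
    by (simp add: sum.reindex inj_on_def)
  also have "\<dots> = (\<Sum>T\<in>Pow (prime_factors N). (\<Prod>l\<in>T. - 1 / of_nat l) * (\<Prod>l\<in>prime_factors N - T. 1))"
  proof (intro sum.cong refl)
    fix T
    have "(\<Prod>l\<in>T. - 1 / of_nat l :: complex) = (\<Prod>l\<in>T. - 1) / (\<Prod>l\<in>T. of_nat l)"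
      by (rule prod_dividef)
    then show "sieve_weight (T, 0) = (\<Prod>l\<in>T. - 1 / of_nat l) * (\<Prod>l\<in>prime_factors N - T. 1)"
      by (simp add: sieve_weight_def)
  qed
  also have "\<dots> = (\<Prod>l\<in>prime_factors N. - 1 / of_nat l + 1)" by (rule prod_add[symmetric]) simp
  also have "\<dots> = of_real (\<Prod>l\<in>prime_factors N. 1 - 1 / real l)"
    by (simp add: of_real_prod)
  also have "(\<Prod>l\<in>prime_factors N. 1 - 1 / real l) = totient N / N"
    using totient_formula2[of N] assms by simp
  finally show ?thesis .
qed

context generating_character
begin

definition primitive_elements :: "'p mod_ring set" where
  "primitive_elements = {\<gamma> ^ k | k. coprime k N}"

lemma gamma_pow_primitive_iff: "\<gamma> ^ k \<in> primitive_elements \<longleftrightarrow> coprime k N"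
proof
  assume "\<gamma> ^ k \<in> primitive_elements"
  then obtain k' where k': "\<gamma> ^ k = \<gamma> ^ k'" "coprime k' N" by (auto simp: primitive_elements_def)
  then have "[k' = k] (mod N)" by (simp add: power_eq_iff cong_sym)
  then show "coprime k N" using k'(2) by (rule cong_imp_coprime)
qed (auto simp: primitive_elements_def)

lemma omega_pow_N: "y \<noteq> 0 \<Longrightarrow> N dvd k \<Longrightarrow> \<omega> y ^ k = 1"
proof -
  assume y: "y \<noteq> 0" "N dvd k"
  then obtain i where i: "y = \<gamma> ^ i" using generator by blast
  have "\<omega> y ^ k = \<omega> \<gamma> ^ (i * k)" by (simp add: i omega_pow power_mult)
  then show ?thesis using y by (simp add: omega_gamma_pow)
qed

text \<open>
  For x = \<gamma>^k, the product over the primes l dividing N of 1 - [l divides k] is expanded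
  over the subsets T, and the condition that the product D of T divides k is detected by a
  geometric sum of D-th roots of unity.
\<close>
lemma primitive_indicator:
  assumes "x \<noteq> 0"
  shows "of_bool (x \<in> primitive_elements) = (\<Sum>t\<in>sieve_index N. sieve_weight t * \<omega> x ^ sieve_exponent N t)"
proof -
  obtain k where k: "x = \<gamma> ^ k" using generator[OF assms] by blast
  let ?F = "prime_factors N"
  have prm: "prime l" if "l \<in> ?F" for l using that by auto
  have cop: "coprime k N \<longleftrightarrow> (\<forall>l\<in>?F. \<not> l dvd k)"
  proof
    assume c: "coprime k N"
    show "\<forall>l\<in>?F. \<not> l dvd k"
    proof
      fix l assume "l \<in> ?F"
      then have "prime l" "l dvd N" by auto
      then show "\<not> l dvd k" using c by (meson coprime_common_divisor not_prime_unit)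
    qed
  next
    assume *: "\<forall>l\<in>?F. \<not> l dvd k"
    show "coprime k N"
    proof (rule ccontr)
      assume "\<not> coprime k N"
      then have "gcd k N \<noteq> 1" by (simp only: coprime_iff_gcd_eq_1 not_False_eq_True)
      then obtain l where "prime l" "l dvd gcd k N" using prime_factor_nat by blast
      then show False using * N_pos by (auto simp: in_prime_factors_iff)
    qed
  qed
  have inner: "(\<Sum>j<\<Prod>T. \<omega> x ^ (j * (N div \<Prod>T))) = of_nat (\<Prod>T) * of_bool (\<Prod>T dvd k)" if T: "T \<subseteq> ?F" for T
  proof -
    let ?D = "\<Prod>T"
    obtain c where c: "N = ?D * c" using sieve_modulus(1)[OF N_pos T] by auto
    have Dc: "?D > 0" "c > 0" "N div ?D = c" using sieve_modulus(2)[OF N_pos T] c N_pos by (auto intro: Nat.gr0I)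
    define z where "z = \<omega> \<gamma> ^ (k * c)"
    have z1: "z = 1 \<longleftrightarrow> ?D dvd k"
      using Dc by (simp only: z_def omega_gamma_pow c) simp
    have zD: "z ^ ?D = 1"
    proof -
      have "z ^ ?D = \<omega> \<gamma> ^ (k * (?D * c))" by (simp add: z_def mult_ac flip: power_mult)
      also have "\<dots> = 1" by (simp only: omega_gamma_pow flip: c) simp
      finally show ?thesis .
    qed
    have "(\<Sum>j<?D. \<omega> x ^ (j * (N div ?D))) = (\<Sum>j<?D. z ^ j)"
      by (intro sum.cong refl) (simp only: k Dc z_def omega_pow power_mult[symmetric] mult_ac)
    also have "\<dots> = of_nat ?D * of_bool (?D dvd k)"
    proof (cases "z = 1")
      case True
      then show ?thesis using z1 by (simp del: of_nat_prod)
    next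
      case False
      then have "(\<Sum>j<?D. z ^ j) = (z ^ ?D - 1) / (z - 1)" by (rule geometric_sum)
      then show ?thesis using z1 zD False by simp
    qed
    finally show ?thesis .
  qed
  have "of_bool (x \<in> primitive_elements) = (\<Prod>l\<in>?F. - of_bool (l dvd k) + 1 :: complex)"
  proof (cases "\<exists>l\<in>?F. l dvd k")
    case True
    then have "(\<Prod>l\<in>?F. - of_bool (l dvd k) + 1 :: complex) = 0" by (intro prod_zero) auto
    then show ?thesis using True by (simp add: k gamma_pow_primitive_iff cop)
  next
    case False
    then have "(\<Prod>l\<in>?F. - of_bool (l dvd k) + 1 :: complex) = 1" by (intro prod.neutral) auto
    then show ?thesis using False by (simp add: k gamma_pow_primitive_iff cop)
  qed
  also have "\<dots> = (\<Sum>T\<in>Pow ?F. (\<Prod>l\<in>T. - of_bool (l dvd k)) * (\<Prod>l\<in>?F - T. 1))"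
    by (rule prod_add) simp
  also have "\<dots> = (\<Sum>T\<in>Pow ?F. \<Sum>j<\<Prod>T. sieve_weight (T, j) * \<omega> x ^ sieve_exponent N (T, j))"
  proof (intro sum.cong refl)
    fix T assume "T \<in> Pow ?F"
    then have T: "T \<subseteq> ?F" by simp
    then have fin: "finite T" by (rule finite_subset) auto
    have "of_bool (\<Prod>T dvd k) = (\<Prod>l\<in>T. of_bool (l dvd k) :: complex)"
    proof (cases "\<exists>l\<in>T. \<not> l dvd k")
      case True
      then have "(\<Prod>l\<in>T. of_bool (l dvd k) :: complex) = 0" using fin by (intro prod_zero) auto
      then show ?thesis using True T prm by (subst prod_primes_dvd_iff[OF fin]) auto
    next
      case False
      then have "(\<Prod>l\<in>T. of_bool (l dvd k) :: complex) = 1" by (intro prod.neutral) auto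
      then show ?thesis using False T prm by (subst prod_primes_dvd_iff[OF fin]) auto
    qed
    then have eq: "(\<Prod>l\<in>T. - of_bool (l dvd k) :: complex) = (-1) ^ card T * of_bool (\<Prod>T dvd k)"
      by (simp add: prod_uminus)
    have "of_nat (\<Prod>T) \<noteq> (0::complex)" using sieve_modulus(2)[OF N_pos T] by (simp del: of_nat_prod)
    moreover have "(\<Sum>j<\<Prod>T. sieve_weight (T, j) * \<omega> x ^ sieve_exponent N (T, j)) =
        (-1) ^ card T / of_nat (\<Prod>T) * (\<Sum>j<\<Prod>T. \<omega> x ^ (j * (N div \<Prod>T)))"
      by (simp only: sieve_weight_def sieve_exponent_def case_prod_conv sum_distrib_left)
    ultimately have "(-1) ^ card T * of_bool (\<Prod>T dvd k) = (\<Sum>j<\<Prod>T. sieve_weight (T, j) * \<omega> x ^ sieve_exponent N (T, j))"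
      unfolding inner[OF T] by simp
    then show "(\<Prod>l\<in>T. - of_bool (l dvd k)) * (\<Prod>l\<in>?F - T. 1) = (\<Sum>j<\<Prod>T. sieve_weight (T, j) * \<omega> x ^ sieve_exponent N (T, j))"
      using eq by simp
  qed
  also have "\<dots> = (\<Sum>t\<in>sieve_index N. sieve_weight t * \<omega> x ^ sieve_exponent N t)"
    unfolding sieve_index_def by (subst sum.Sigma) (auto simp: case_prod_unfold)
  finally show ?thesis .
qed

text \<open>
  On J itself a trivial character must be kept from contributing 0^0 = 1. Summing
  over the complement of J and comparing with the full sum changes the result by at most card J.
\<close>
lemma character_sum_outside:
  assumes J: "J \<noteq> UNIV" "J \<noteq> {}"
  shows "norm ((\<Sum>x\<in>-J. \<Prod>b\<in>J. \<omega> (b - x) ^ k b) - of_bool (\<forall>b\<in>J. N dvd k b) * of_real (real CARD('p) - real (card J)))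
           \<le> 2 * card J * sqrt CARD('p)"
proof -
  define I where "I = {b \<in> J. \<not> N dvd k b}"
  have eq: "(\<Prod>b\<in>J. \<omega> (b - x) ^ k b) = (\<Prod>b\<in>I. \<omega> (b - x) ^ k b)" if "x \<notin> J" for x
    using that by (intro prod.mono_neutral_right) (auto simp: I_def intro!: omega_pow_N)
  have sp: "sqrt CARD('p) \<ge> 1" using prime_ge_1_nat[OF prime_card[where ?'a='p]] by simp
  show ?thesis
  proof (cases "I = {}")
    case True
    then have "\<forall>b\<in>J. N dvd k b" by (auto simp: I_def)
    moreover have "(\<Sum>x\<in>-J. \<Prod>b\<in>J. \<omega> (b - x) ^ k b) = of_real (real CARD('p) - real (card J))"
    proof -
      have "card (-J) = CARD('p) - card J" by (simp add: Compl_eq_Diff_UNIV card_Diff_subset)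
      moreover have "card J \<le> CARD('p)" using card_mono[of UNIV J] by simp
      ultimately show ?thesis using eq True by (simp add: of_nat_diff)
    qed
    ultimately show ?thesis by simp
  next
    case False
    then obtain a where a: "a \<in> I" by auto
    have "\<not> (\<forall>b\<in>J. N dvd k b)" using a by (auto simp: I_def)
    have IJ: "I \<subseteq> J" by (auto simp: I_def)
    have W: "norm (\<Sum>x\<in>UNIV. \<Prod>b\<in>I. \<omega> (b - x) ^ k b) \<le> real (card I - 1) * sqrt (real CARD('p))"
      using IJ J a by (intro weil_bound) (auto simp: I_def)
    have "(\<Sum>x\<in>UNIV. \<Prod>b\<in>I. \<omega> (b - x) ^ k b) =
          (\<Sum>x\<in>-J. \<Prod>b\<in>I. \<omega> (b - x) ^ k b) + (\<Sum>x\<in>J. \<Prod>b\<in>I. \<omega> (b - x) ^ k b)"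
      by (subst sum.union_disjoint[symmetric]) (auto simp: Un_commute Compl_partition)
    then have split: "(\<Sum>x\<in>-J. \<Prod>b\<in>J. \<omega> (b - x) ^ k b) =
          (\<Sum>x\<in>UNIV. \<Prod>b\<in>I. \<omega> (b - x) ^ k b) - (\<Sum>x\<in>J. \<Prod>b\<in>I. \<omega> (b - x) ^ k b)"
      using eq by simp
    have "norm (\<Sum>x\<in>J. \<Prod>b\<in>I. \<omega> (b - x) ^ k b) \<le> (\<Sum>x\<in>J. 1)"
    proof (rule sum_norm_le)
      fix x
      have "norm (\<Prod>b\<in>I. \<omega> (b - x) ^ k b) = (\<Prod>b\<in>I. norm (\<omega> (b - x)) ^ k b)"
        by (simp add: prod_norm norm_power flip: norm_power)
      also have "\<dots> \<le> 1" by (intro prod_le_1) (auto intro!: power_le_one norm_omega_le)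
      finally show "norm (\<Prod>b\<in>I. \<omega> (b - x) ^ k b) \<le> 1" .
    qed
    then have "norm (\<Sum>x\<in>-J. \<Prod>b\<in>J. \<omega> (b - x) ^ k b) \<le> real (card I - 1) * sqrt (real CARD('p)) + real (card J)"
      unfolding split using W norm_triangle_ineq4[of "\<Sum>x\<in>UNIV. \<Prod>b\<in>I. \<omega> (b - x) ^ k b" "\<Sum>x\<in>J. \<Prod>b\<in>I. \<omega> (b - x) ^ k b"]
      by simp
    also have "\<dots> \<le> card J * sqrt CARD('p) + card J * sqrt CARD('p)"
    proof (intro add_mono mult_right_mono)
      show "real (card I - 1) \<le> card J" using card_mono[OF _ IJ] by simp
      show "real (card J) \<le> card J * sqrt CARD('p)" using sp by (simp add: mult_le_cancel_left1)
    qed simp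
    finally have bound: "norm (\<Sum>x\<in>-J. \<Prod>b\<in>J. \<omega> (b - x) ^ k b) \<le> card J * sqrt CARD('p) + card J * sqrt CARD('p)" .
    have nontriv: "of_bool (\<forall>b\<in>J. N dvd k b) = (0 :: complex)"
      using \<open>\<not> (\<forall>b\<in>J. N dvd k b)\<close> by (simp only: of_bool_eq)
    show ?thesis unfolding nontriv mult_zero_left diff_0_right using bound by simp
  qed
qed

text \<open>
  The factor u b is needed for the condition that x itself is primitive, which has the form
  u (0 - x) with u = -1; it changes the weights by a factor of absolute value 1.
\<close>
lemma count_primitive_elements:
  assumes J: "J \<noteq> UNIV" "J \<noteq> {}" and u: "\<And>b. b \<in> J \<Longrightarrow> u b \<noteq> 0"
  shows "\<bar>real (card {x. \<forall>b\<in>J. u b * (b - x) \<in> primitive_elements}) -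
           (totient N / N) ^ card J * (real CARD('p) - card J)\<bar>
          \<le> (2 ^ card (prime_factors N)) ^ card J * (2 * card J * sqrt CARD('p))"
proof -
  let ?X = "sieve_index N" and ?e = "sieve_exponent N"
  let ?A = "{x. \<forall>b\<in>J. u b * (b - x) \<in> primitive_elements}"
  let ?m = "real CARD('p) - card J"
  have finJ: "finite J" by simp
  define w where "w = (\<lambda>b t. sieve_weight t * \<omega> (u b) ^ ?e t)"
  define W where "W = (\<lambda>\<tau>. \<Prod>b\<in>J. w b (\<tau> b))"
  define E where "E = (\<lambda>\<tau>. \<Sum>x\<in>-J. \<Prod>b\<in>J. \<omega> (b - x) ^ ?e (\<tau> b))"
  have zero: "0 \<notin> primitive_elements" using gamma_nz by (auto simp: primitive_elements_def)
  have AJ: "?A \<subseteq> -J" using zero by force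
  have "of_nat (card ?A) = (\<Sum>x\<in>-J. of_bool (x \<in> ?A) :: complex)"
    using AJ by (simp add: Int_absorb1 inf.absorb2)
  also have "\<dots> = (\<Sum>x\<in>-J. \<Prod>b\<in>J. of_bool (u b * (b - x) \<in> primitive_elements))"
  proof (intro sum.cong refl)
    fix x
    show "of_bool (x \<in> ?A) = (\<Prod>b\<in>J. of_bool (u b * (b - x) \<in> primitive_elements) :: complex)"
    proof (cases "x \<in> ?A")
      case True then show ?thesis by simp
    next
      case False
      then have "(\<Prod>b\<in>J. of_bool (u b * (b - x) \<in> primitive_elements) :: complex) = 0"
        by (intro prod_zero) auto
      then show ?thesis using False by simp
    qed
  qed
  also have "\<dots> = (\<Sum>x\<in>-J. \<Prod>b\<in>J. \<Sum>t\<in>?X. w b t * \<omega> (b - x) ^ ?e t)"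
  proof (intro sum.cong prod.cong refl)
    fix x b assume "x \<in> -J" "b \<in> J"
    then have "u b * (b - x) \<noteq> 0" using u by auto
    then show "of_bool (u b * (b - x) \<in> primitive_elements) = (\<Sum>t\<in>?X. w b t * \<omega> (b - x) ^ ?e t)"
      by (simp add: primitive_indicator w_def omega_mult power_mult_distrib mult.assoc)
  qed
  also have "\<dots> = (\<Sum>x\<in>-J. \<Sum>\<tau>\<in>PiE J (\<lambda>_. ?X). \<Prod>b\<in>J. w b (\<tau> b) * \<omega> (b - x) ^ ?e (\<tau> b))"
    by (intro sum.cong refl prod_sum_PiE finJ finite_sieve_index)
  also have "\<dots> = (\<Sum>\<tau>\<in>PiE J (\<lambda>_. ?X). \<Sum>x\<in>-J. \<Prod>b\<in>J. w b (\<tau> b) * \<omega> (b - x) ^ ?e (\<tau> b))"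
    by (rule sum.swap)
  also have "\<dots> = (\<Sum>\<tau>\<in>PiE J (\<lambda>_. ?X). W \<tau> * E \<tau>)"
    by (simp add: W_def E_def prod.distrib sum_distrib_left)
  finally have count: "of_nat (card ?A) = \<dots>" .
  have main: "(\<Sum>\<tau>\<in>PiE J (\<lambda>_. ?X). W \<tau> * (of_bool (\<forall>b\<in>J. N dvd ?e (\<tau> b)) * of_real ?m)) =
        of_real ((totient N / N) ^ card J * ?m)"
  proof -
    have ob: "of_bool (\<forall>b\<in>J. N dvd ?e (\<tau> b)) = (\<Prod>b\<in>J. of_bool (N dvd ?e (\<tau> b)) :: complex)" for \<tau>
    proof (cases "\<forall>b\<in>J. N dvd ?e (\<tau> b)")
      case False
      then have "(\<Prod>b\<in>J. of_bool (N dvd ?e (\<tau> b)) :: complex) = 0" by (intro prod_zero) auto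
      then show ?thesis using False by simp
    qed simp
    have "(\<Sum>\<tau>\<in>PiE J (\<lambda>_. ?X). W \<tau> * (of_bool (\<forall>b\<in>J. N dvd ?e (\<tau> b)) * of_real ?m)) =
          (\<Sum>\<tau>\<in>PiE J (\<lambda>_. ?X). \<Prod>b\<in>J. w b (\<tau> b) * of_bool (N dvd ?e (\<tau> b))) * of_real ?m"
      unfolding ob W_def sum_distrib_right prod.distrib by (simp only: mult.assoc)
    also have "(\<Sum>\<tau>\<in>PiE J (\<lambda>_. ?X). \<Prod>b\<in>J. w b (\<tau> b) * of_bool (N dvd ?e (\<tau> b))) =
          (\<Prod>b\<in>J. \<Sum>t\<in>?X. w b t * of_bool (N dvd ?e t))"
      by (rule prod_sum_PiE[symmetric]) (auto simp: finite_sieve_index)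
    also have "\<dots> = (\<Prod>b\<in>J. of_real (totient N / N))"
    proof (intro prod.cong refl)
      fix b assume b: "b \<in> J"
      have "(\<Sum>t\<in>?X. w b t * of_bool (N dvd ?e t)) = (\<Sum>t\<in>?X. if N dvd ?e t then sieve_weight t else 0)"
        using u[OF b] by (intro sum.cong refl) (simp add: w_def omega_pow_N)
      also have "\<dots> = (\<Sum>t | t \<in> ?X \<and> N dvd ?e t. sieve_weight t)"
        by (rule sum.inter_filter[symmetric]) (rule finite_sieve_index)
      finally show "(\<Sum>t\<in>?X. w b t * of_bool (N dvd ?e t)) = of_real (totient N / N)"
        by (simp only: sum_trivial_sieve_weight[OF N_pos])
    qed
    finally show ?thesis by simp
  qed
  have "complex_of_real (real (card ?A) - (totient N / N) ^ card J * ?m) =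
        of_nat (card ?A) - of_real ((totient N / N) ^ card J * ?m)" by simp
  also have "\<dots> = (\<Sum>\<tau>\<in>PiE J (\<lambda>_. ?X). W \<tau> * (E \<tau> - of_bool (\<forall>b\<in>J. N dvd ?e (\<tau> b)) * of_real ?m))"
    unfolding count main[symmetric] by (simp add: right_diff_distrib sum_subtractf)
  finally have "norm (complex_of_real (real (card ?A) - (totient N / N) ^ card J * ?m)) = norm \<dots>"
    by (rule arg_cong)
  then have "\<bar>real (card ?A) - (totient N / N) ^ card J * ?m\<bar> =
      norm (\<Sum>\<tau>\<in>PiE J (\<lambda>_. ?X). W \<tau> * (E \<tau> - of_bool (\<forall>b\<in>J. N dvd ?e (\<tau> b)) * of_real ?m))"
    by (simp only: norm_of_real)
  also have "\<dots> \<le> (\<Sum>\<tau>\<in>PiE J (\<lambda>_. ?X). norm (W \<tau>) * (2 * card J * sqrt CARD('p)))"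
  proof (rule sum_norm_le)
    fix \<tau>
    show "norm (W \<tau> * (E \<tau> - of_bool (\<forall>b\<in>J. N dvd ?e (\<tau> b)) * of_real ?m)) \<le> norm (W \<tau>) * (2 * card J * sqrt CARD('p))"
      unfolding norm_mult E_def using character_sum_outside[OF J, of "\<lambda>b. ?e (\<tau> b)"]
      by (intro mult_left_mono) auto
  qed
  also have "\<dots> = (\<Sum>\<tau>\<in>PiE J (\<lambda>_. ?X). \<Prod>b\<in>J. norm (w b (\<tau> b))) * (2 * card J * sqrt CARD('p))"
    by (simp add: W_def prod_norm sum_distrib_right)
  also have "(\<Sum>\<tau>\<in>PiE J (\<lambda>_. ?X). \<Prod>b\<in>J. norm (w b (\<tau> b))) = (\<Prod>b\<in>J. \<Sum>t\<in>?X. norm (w b t))"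
    by (rule prod_sum_PiE[symmetric]) (auto simp: finite_sieve_index)
  also have "\<dots> = (\<Prod>b\<in>J. 2 ^ card (prime_factors N))"
    using u sum_norm_sieve_weight[OF N_pos]
    by (intro prod.cong refl) (simp add: w_def norm_mult norm_power norm_omega)
  finally show ?thesis by simp
qed

end


section \<open>From finite fields to residues\<close>

text \<open>
  A prime l with l^\<delta> \<ge> 2 pays for its own factor 2, and the number of other primes is bounded.
\<close>
lemma two_power_prime_factors_bound:
  assumes "\<delta> > 0"
  shows "\<exists>K>0. \<forall>n>0. 2 ^ card (prime_factors n) \<le> K * real n powr \<delta>"
proof -
  define M where "M = nat \<lceil>2 powr (1 / \<delta>)\<rceil>"
  have "2 ^ card (prime_factors n) \<le> 2 ^ M * real n powr \<delta>" if n: "n > 0" for n :: nat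
  proof -
    define A where "A = {l \<in> prime_factors n. l < M}"
    define B where "B = {l \<in> prime_factors n. l \<ge> M}"
    have fin: "finite A" "finite B" by (auto simp: A_def B_def)
    have "prime_factors n = A \<union> B" "A \<inter> B = {}" by (auto simp: A_def B_def)
    then have "card (prime_factors n) = card A + card B" using fin by (simp add: card_Un_disjoint)
    then have eq: "(2::real) ^ card (prime_factors n) = 2 ^ card A * 2 ^ card B" by (simp add: power_add)
    have "card A \<le> M" using card_mono[of "{..<M}" A] by (auto simp: A_def)
    then have A: "(2::real) ^ card A \<le> 2 ^ M" by (rule power_increasing) simp
    have "(2::real) ^ card B = (\<Prod>l\<in>B. 2)" by simp
    also have "\<dots> \<le> (\<Prod>l\<in>B. real l powr \<delta>)"
    proof (intro prod_mono conjI)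
      fix l assume "l \<in> B"
      then have "2 powr (1 / \<delta>) \<le> real l" by (simp add: B_def M_def nat_le_iff ceiling_le_iff)
      then have "(2 powr (1 / \<delta>)) powr \<delta> \<le> real l powr \<delta>" using assms by (intro powr_mono2) auto
      then show "2 \<le> real l powr \<delta>" using assms by (simp add: powr_powr)
    qed simp
    also have "\<dots> = real (\<Prod>B) powr \<delta>" by (simp add: prod_powr_distrib)
    also have "\<dots> \<le> real n powr \<delta>"
    proof -
      have "\<Prod>B dvd n" using sieve_modulus(1)[OF n, of B] by (auto simp: B_def)
      then have "\<Prod>B \<le> n" using n by (rule dvd_imp_le)
      then show ?thesis using assms by (intro powr_mono2) (auto simp del: of_nat_prod)
    qed
    finally show ?thesis unfolding eq using A by (intro mult_mono) auto
  qed
  then show ?thesis by (intro exI[of _ "2 ^ M"]) auto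
qed

definition primroot_tuples_estimate :: "nat \<Rightarrow> bool" where
  "primroot_tuples_estimate p \<longleftrightarrow> (\<forall>as. as \<noteq> [] \<and> distinct as \<and> set as \<subseteq> {1..p - 1} \<and> length as + 1 < p \<longrightarrow>
     \<bar>real (num_primroot_tuples as p) - real (totient (p - 1)) ^ (length as + 1) / real p ^ length as\<bar>
       \<le> 3 * real (length as + 1) * (2 ^ card (prime_factors (p - 1))) ^ (length as + 1) * sqrt p)"

lemma (in generating_character) bij_betw_primitive_roots:
  assumes \<gamma>: "\<gamma> = of_nat g" and g: "residue_primroot CARD('p) g"
  shows "bij_betw of_nat (primitive_roots CARD('p)) primitive_elements"
proof -
  let ?p = "CARD('p)"
  have p: "prime ?p" by (rule prime_card)
  have tot: "totient ?p = N" using totient_prime[OF p] by (simp add: N_eq)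
  have ord: "ord ?p g = N" and cop: "coprime ?p g" using g by (auto simp: residue_primroot_def tot)
  have eqc: "(of_nat a :: 'p mod_ring) = of_nat b \<longleftrightarrow> [a = b] (mod ?p)" for a b
    by (simp add: of_nat_eq_iff_cong_CHAR)
  have pr: "residue_primroot ?p (g ^ k) \<longleftrightarrow> coprime k N" for k
  proof -
    have *: "ord ?p (g ^ k) * gcd k N = N" using ord_power_aux[of ?p g k] by (simp add: ord)
    have "coprime ?p (g ^ k)" using cop by simp
    then have "residue_primroot ?p (g ^ k) \<longleftrightarrow> ord ?p (g ^ k) = N"
      using prime_gt_0_nat[OF p] by (simp add: residue_primroot_def tot)
    also have "\<dots> \<longleftrightarrow> gcd k N = 1"
    proof
      assume "ord ?p (g ^ k) = N"
      then have "N * gcd k N = N * 1" using * by simp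
      then show "gcd k N = 1" using N_pos by (simp only: mult_cancel1) simp
    next
      assume "gcd k N = 1"
      then show "ord ?p (g ^ k) = N" using * by simp
    qed
    finally show ?thesis by (simp only: coprime_iff_gcd_eq_1)
  qed
  have iff: "of_nat i \<in> primitive_elements \<longleftrightarrow> residue_primroot ?p i" if "\<not> ?p dvd i" for i
  proof -
    have "(of_nat i :: 'p mod_ring) \<noteq> 0" using that eqc[of i 0] by (simp add: cong_0_iff)
    then obtain k where k: "of_nat i = \<gamma> ^ k" using generator by blast
    then have "of_nat i = (of_nat (g ^ k) :: 'p mod_ring)" by (simp add: \<gamma>)
    then have "[i = g ^ k] (mod ?p)" by (simp only: eqc)
    then show ?thesis using pr[of k] by (simp only: residue_primroot_cong k gamma_pow_primitive_iff)
  qed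
  have nd: "\<not> ?p dvd i" if "i \<in> {1..?p - 1}" for i
    using that by (auto dest: dvd_imp_le)
  show ?thesis
  proof (rule bij_betw_imageI)
    show "inj_on (of_nat :: nat \<Rightarrow> 'p mod_ring) (primitive_roots ?p)"
    proof (rule inj_onI)
      fix i j assume ij: "i \<in> primitive_roots ?p" "j \<in> primitive_roots ?p" "(of_nat i :: 'p mod_ring) = of_nat j"
      then have "[i = j] (mod ?p)" by (simp add: eqc)
      then show "i = j" using ij by (intro cong_less_modulus_unique_nat[of i j ?p]) (auto simp: primitive_roots_def)
    qed
    show "of_nat ` primitive_roots ?p = primitive_elements"
    proof (intro equalityI subsetI)
      fix x :: "'p mod_ring" assume "x \<in> of_nat ` primitive_roots ?p"
      then show "x \<in> primitive_elements" using iff nd by (auto simp: primitive_roots_def)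
    next
      fix x :: "'p mod_ring" assume x: "x \<in> primitive_elements"
      obtain i where i: "i < ?p" "x = of_nat i" using surj_of_nat_mod_ring by blast
      have "x \<noteq> 0" using x gamma_nz by (auto simp: primitive_elements_def)
      then have "i \<in> {1..?p - 1}" using i by (cases i) auto
      then show "x \<in> of_nat ` primitive_roots ?p"
        using iff[OF nd] x i by (auto simp: primitive_roots_def)
    qed
  qed
qed

lemma (in generating_character) num_primroot_tuples_eq:
  assumes bij: "bij_betw of_nat (primitive_roots CARD('p)) primitive_elements"
  shows "num_primroot_tuples as CARD('p) =
           card {x. x \<in> primitive_elements \<and> (\<forall>a\<in>set as. of_nat a - x \<in> primitive_elements)}"
  unfolding num_primroot_tuples_def
proof (rule bij_betw_same_card)
  let ?p = "CARD('p)" and ?R = "primitive_roots CARD('p)"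
  let ?A = "{x. x \<in> primitive_elements \<and> (\<forall>a\<in>set as. of_nat a - x \<in> primitive_elements)}"
  have inj: "inj_on (of_nat :: nat \<Rightarrow> 'p mod_ring) ?R" and img: "of_nat ` ?R = primitive_elements"
    using bij by (auto simp: bij_betw_def)
  have eqc: "[a + b = c] (mod ?p) \<longleftrightarrow> of_nat a = (of_nat c - of_nat b :: 'p mod_ring)" for a b c
  proof -
    have "[a + b = c] (mod ?p) \<longleftrightarrow> (of_nat (a + b) :: 'p mod_ring) = of_nat c"
      by (simp only: of_nat_eq_iff_cong_CHAR semiring_char_mod_ring)
    then show ?thesis by (simp add: eq_diff_eq)
  qed
  show "bij_betw (\<lambda>(\<alpha>s, \<beta>). of_nat \<beta>) (primroot_tuples as ?p) ?A"
  proof (rule bij_betw_imageI)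
    show "inj_on (\<lambda>(\<alpha>s, \<beta>). of_nat \<beta> :: 'p mod_ring) (primroot_tuples as ?p)"
    proof (rule inj_onI, clarify)
      fix \<alpha>s \<beta> \<alpha>s' \<beta>'
      assume t: "(\<alpha>s, \<beta>) \<in> primroot_tuples as ?p" "(\<alpha>s', \<beta>') \<in> primroot_tuples as ?p"
        and e: "(of_nat \<beta> :: 'p mod_ring) = of_nat \<beta>'"
      then have b: "\<beta> = \<beta>'" using inj by (auto simp: primroot_tuples_def inj_on_def)
      have "\<alpha>s = \<alpha>s'"
      proof (rule nth_equalityI)
        show "length \<alpha>s = length \<alpha>s'" using t by (auto simp: primroot_tuples_def)
        fix i assume i: "i < length \<alpha>s"
        then have "(of_nat (\<alpha>s ! i) :: 'p mod_ring) = of_nat (\<alpha>s' ! i)"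
          using t b by (simp add: primroot_tuples_def eqc)
        moreover have "\<alpha>s ! i \<in> ?R" "\<alpha>s' ! i \<in> ?R"
          using t i by (auto simp: primroot_tuples_def)
        ultimately show "\<alpha>s ! i = \<alpha>s' ! i" using inj by (auto simp: inj_on_def)
      qed
      then show "\<alpha>s = \<alpha>s' \<and> \<beta> = \<beta>'" using b by simp
    qed
    show "(\<lambda>(\<alpha>s, \<beta>). of_nat \<beta> :: 'p mod_ring) ` primroot_tuples as ?p = ?A"
    proof (intro equalityI subsetI)
      fix x assume "x \<in> (\<lambda>(\<alpha>s, \<beta>). of_nat \<beta> :: 'p mod_ring) ` primroot_tuples as ?p"
      then obtain \<alpha>s \<beta> where t: "(\<alpha>s, \<beta>) \<in> primroot_tuples as ?p" "x = of_nat \<beta>" by auto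
      have "of_nat (as ! i) - x \<in> primitive_elements" if "i < length as" for i
      proof -
        have "of_nat (\<alpha>s ! i) = of_nat (as ! i) - x" using t that by (simp add: primroot_tuples_def eqc)
        moreover have "\<alpha>s ! i \<in> ?R" using t that by (auto simp: primroot_tuples_def)
        ultimately show ?thesis using img by (metis imageI)
      qed
      moreover have "x \<in> primitive_elements" using t img by (auto simp: primroot_tuples_def)
      ultimately show "x \<in> ?A" by (auto simp: in_set_conv_nth)
    next
      fix x assume x: "x \<in> ?A"
      define \<rho> where "\<rho> = inv_into ?R (of_nat :: nat \<Rightarrow> 'p mod_ring)"
      have rho: "\<rho> y \<in> ?R" "of_nat (\<rho> y) = y" if "y \<in> primitive_elements" for y
        using that img unfolding \<rho>_def by (metis inv_into_into, metis f_inv_into_f)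
      have "(map (\<lambda>a. \<rho> (of_nat a - x)) as, \<rho> x) \<in> primroot_tuples as ?p"
        using x rho by (auto simp: primroot_tuples_def eqc)
      moreover have "x = of_nat (\<rho> x)" using x rho by simp
      ultimately show "x \<in> (\<lambda>(\<alpha>s, \<beta>). of_nat \<beta> :: 'p mod_ring) ` primroot_tuples as ?p"
        by (intro image_eqI[of _ _ "(map (\<lambda>a. \<rho> (of_nat a - x)) as, \<rho> x)"]) simp_all
    qed
  qed
qed

text \<open>
  Bernoulli's inequality gives p - s \<le> p (1 - 1/p)^s \<le> p.
\<close>
lemma main_term_difference:
  fixes x :: real
  assumes p: "p > 1" and s: "s \<ge> 1" and x: "0 \<le> x" "x \<le> real (p - 1)"
  shows "\<bar>(x / real (p - 1)) ^ s * (real p - s) - x ^ s / real p ^ (s - 1)\<bar> \<le> s"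
proof -
  define N where "N = real (p - 1)"
  have N: "N > 0" "real p = N + 1" using p by (auto simp: N_def)
  define y where "y = (x / N) ^ s"
  have xN: "x \<le> N" using x(2) unfolding N_def .
  have "0 \<le> x / N" "x / N \<le> 1" using x(1) xN N(1) by simp_all
  then have y: "0 \<le> y" "y \<le> 1" unfolding y_def by (simp_all add: power_le_one)
  have "x ^ s / real p ^ (s - 1) = y * (real p * (1 + - 1 / real p) ^ s)"
  proof -
    have "real p ^ s = real p ^ (s - 1) * real p" using s by (metis power_minus_mult less_le_trans zero_less_one)
    moreover have "(1 + - 1 / real p) = N / real p" using N by (simp add: field_simps)
    ultimately show ?thesis using N by (simp add: y_def power_divide)
  qed
  moreover have "real p - s \<le> real p * (1 + - 1 / real p) ^ s"
  proof -
    have "1 + real s * (- 1 / real p) \<le> (1 + - 1 / real p) ^ s"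
      using N by (intro Bernoulli_inequality) (simp add: field_simps)
    then have "real p * (1 + real s * (- 1 / real p)) \<le> real p * (1 + - 1 / real p) ^ s"
      by (intro mult_left_mono) auto
    moreover have "real p * (1 + real s * (- 1 / real p)) = real p - s" using p by (simp add: field_simps)
    ultimately show ?thesis by simp
  qed
  moreover have "real p * (1 + - 1 / real p) ^ s \<le> real p * 1"
    using N by (intro mult_left_mono power_le_one) (auto simp: field_simps)
  ultimately have "\<bar>y * (real p - s) - x ^ s / real p ^ (s - 1)\<bar> = y * (real p * (1 + - 1 / real p) ^ s - (real p - s))"
    and "real p * (1 + - 1 / real p) ^ s - (real p - s) \<le> s"
    using y by (auto simp: abs_mult simp flip: right_diff_distrib)
  moreover have "real p * (1 + - 1 / real p) ^ s - (real p - s) \<ge> 0"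
    using \<open>real p - s \<le> real p * (1 + - 1 / real p) ^ s\<close> by simp
  ultimately have "\<bar>y * (real p - s) - x ^ s / real p ^ (s - 1)\<bar> \<le> 1 * real s"
    using y mult_mono[of y 1 "real p * (1 + - 1 / real p) ^ s - (real p - s)" "real s"] by simp
  then show ?thesis by (simp add: y_def N_def)
qed

lemma primroot_tuples_estimate_card: "primroot_tuples_estimate CARD('p::prime_card)"
  unfolding primroot_tuples_estimate_def
proof (intro allI impI, elim conjE)
  fix as :: "nat list"
  let ?p = "CARD('p)"
  let ?s = "length as + 1"
  assume as: "as \<noteq> []" "distinct as" "set as \<subseteq> {1..?p - 1}" "?s < ?p"
  have p: "prime ?p" by (rule prime_card)
  obtain g where g: "residue_primroot ?p g" using prime_primitive_root_exists[OF prime_gt_1_nat[OF p] p] by blast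
  obtain \<omega> where "generating_character (of_nat g :: 'p mod_ring) \<omega> (?p - 1)"
    using exists_generating_character[OF g] by blast
  then interpret generating_character "of_nat g :: 'p mod_ring" \<omega> "?p - 1" .
  have bij: "bij_betw of_nat (primitive_roots ?p) primitive_elements"
    by (rule bij_betw_primitive_roots[OF refl g])
  have inj: "inj_on (of_nat :: nat \<Rightarrow> 'p mod_ring) {..<?p}"
    by (auto simp: inj_on_def of_nat_eq_iff_cong_CHAR intro: cong_less_modulus_unique_nat)
  define J where "J = (of_nat ` insert 0 (set as) :: 'p mod_ring set)"
  define u where "u = (\<lambda>b :: 'p mod_ring. if b = 0 then - 1 else 1 :: 'p mod_ring)"
  have "{1..?p - 1} \<subseteq> {..<?p}" by auto
  then have sub: "insert 0 (set as) \<subseteq> {..<?p}" using as(3,4) by auto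
  have "0 \<notin> set as" using as(3) by auto
  then have "card (insert 0 (set as)) = ?s" using as(2) by (simp add: distinct_card)
  then have cJ: "card J = ?s" unfolding J_def using card_image[OF inj_on_subset[OF inj sub]] by simp
  have nz: "(of_nat a :: 'p mod_ring) \<noteq> 0" if "a \<in> set as" for a
  proof
    assume "(of_nat a :: 'p mod_ring) = 0"
    then have "a = 0" using inj_onD[OF inj, of a 0] that sub by auto
    then show False using that as by auto
  qed
  have "{x. x \<in> primitive_elements \<and> (\<forall>a\<in>set as. of_nat a - x \<in> primitive_elements)} =
        {x. \<forall>b\<in>J. u b * (b - x) \<in> primitive_elements}"
    using nz by (auto simp: J_def u_def)
  then have "num_primroot_tuples as ?p = card {x. \<forall>b\<in>J. u b * (b - x) \<in> primitive_elements}"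
    by (simp add: num_primroot_tuples_eq[OF bij])
  moreover have "J \<noteq> UNIV" using cJ as(4) by auto
  moreover have "J \<noteq> {}" by (simp add: J_def)
  ultimately have 1: "\<bar>real (num_primroot_tuples as ?p) - (totient (?p - 1) / (?p - 1)) ^ ?s * (real ?p - ?s)\<bar>
      \<le> (2 ^ card (prime_factors (?p - 1))) ^ ?s * (2 * ?s * sqrt ?p)"
    using count_primitive_elements[of J u] by (simp only: cJ) (simp add: u_def)
  have 2: "\<bar>(totient (?p - 1) / (?p - 1)) ^ ?s * (real ?p - ?s) - real (totient (?p - 1)) ^ ?s / real ?p ^ length as\<bar> \<le> ?s"
    using main_term_difference[of ?p ?s "totient (?p - 1)"] prime_gt_1_nat[OF p] totient_le[of "?p - 1"] by simp
  let ?B = "(2 ^ card (prime_factors (?p - 1)) :: real) ^ ?s"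
  have "1 * 1 \<le> ?B * sqrt ?p"
    using prime_ge_1_nat[OF p] by (intro mult_mono one_le_power) auto
  then have "real ?s * 1 \<le> real ?s * (?B * sqrt ?p)" by (intro mult_left_mono) auto
  moreover have "\<bar>A - T\<bar> \<le> 3 * real n * B * q"
    if "\<bar>A - M\<bar> \<le> B * (real (2 * n) * q)" "\<bar>M - T\<bar> \<le> real n" "real n * 1 \<le> real n * (B * q)"
    for A M T B q :: real and n :: nat
    using that by (simp add: algebra_simps)
  ultimately show "\<bar>real (num_primroot_tuples as ?p) - real (totient (?p - 1)) ^ ?s / real ?p ^ length as\<bar>
       \<le> 3 * real ?s * ?B * sqrt ?p"
    using 1 2 by blast
qed

text \<open>
  A prime at which the estimate fails, if it fails at any. Being a closed constant, it can serve
  as the cardinality of a type, and a theorem about this one type gives the estimate for every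
  prime. The type is thereby a substitute for one that would depend on a variable p.
\<close>
definition critical_prime :: nat where
  "critical_prime = (SOME p. prime p \<and> (primroot_tuples_estimate p \<longrightarrow> (\<forall>p'. prime p' \<longrightarrow> primroot_tuples_estimate p')))"

lemma critical_prime:
  "prime critical_prime"
  "primroot_tuples_estimate critical_prime \<Longrightarrow> prime p \<Longrightarrow> primroot_tuples_estimate p"
proof -
  have "\<exists>p. prime p \<and> (primroot_tuples_estimate p \<longrightarrow> (\<forall>p'. prime p' \<longrightarrow> primroot_tuples_estimate p'))"
    using two_is_prime_nat by blast
  from someI_ex[OF this, folded critical_prime_def]
  show "prime critical_prime"
    "primroot_tuples_estimate critical_prime \<Longrightarrow> prime p \<Longrightarrow> primroot_tuples_estimate p" by auto
qed

typedef critical_index = "{0..<critical_prime}"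
  using critical_prime(1) by (intro exI[of _ 0]) (auto simp: prime_gt_0_nat)

lemma CARD_critical_index: "CARD(critical_index) = critical_prime"
  using type_definition.card[OF type_definition_critical_index] by simp

instance critical_index :: finite
  by standard (metis type_definition.univ[OF type_definition_critical_index] finite_imageI finite_atLeastLessThan)

instance critical_index :: prime_card
  by standard (simp add: CARD_critical_index critical_prime(1))

lemma primroot_tuples_estimate_prime: "prime p \<Longrightarrow> primroot_tuples_estimate p"
  using primroot_tuples_estimate_card[where 'p = critical_index]
  unfolding CARD_critical_index by (rule critical_prime(2))

theorem mainTheorem1:
  fixes r :: nat and \<epsilon> :: real
  assumes "r > 0" and "\<epsilon> > 0"
  shows "\<exists>(C::real) (p0::nat). C > 0 \<and>
    (\<forall>(p::nat) (as::nat list).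
       prime p \<and> p \<ge> p0 \<and> length as = r \<and> distinct as \<and> set as \<subseteq> {1..p - 1} \<longrightarrow>
       \<bar>real (num_primroot_tuples as p) - real (totient (p - 1)) ^ (r + 1) / real p ^ r\<bar>
         \<le> C * real p powr (1 / 2 + \<epsilon>))"
proof -
  define s where "s = r + 1"
  define \<delta> where "\<delta> = \<epsilon> / s"
  have "\<delta> > 0" using assms by (simp add: \<delta>_def s_def)
  then obtain K where K: "K > 0" "\<And>n::nat. n > 0 \<Longrightarrow> 2 ^ card (prime_factors n) \<le> K * real n powr \<delta>"
    using two_power_prime_factors_bound by blast
  define C where "C = 3 * real s * K ^ s"
  have "\<bar>real (num_primroot_tuples as p) - real (totient (p - 1)) ^ (r + 1) / real p ^ r\<bar> \<le> C * real p powr (1 / 2 + \<epsilon>)"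
    if p: "prime p" "p \<ge> s + 1" and as: "length as = r" "distinct as" "set as \<subseteq> {1..p - 1}" for p as
  proof -
    have p1: "p > 1" using p(1) by (rule prime_gt_1_nat)
    have "\<bar>real (num_primroot_tuples as p) - real (totient (p - 1)) ^ (r + 1) / real p ^ r\<bar>
        \<le> 3 * real s * (2 ^ card (prime_factors (p - 1))) ^ s * sqrt p"
    proof -
      have "as \<noteq> [] \<and> distinct as \<and> set as \<subseteq> {1..p - 1} \<and> length as + 1 < p"
        using as p(2) assms(1) by (auto simp: s_def)
      from primroot_tuples_estimate_prime[OF p(1), unfolded primroot_tuples_estimate_def, rule_format, OF this]
      show ?thesis unfolding as(1) s_def[symmetric] .
    qed
    also have "\<dots> \<le> 3 * real s * (K * real p powr \<delta>) ^ s * sqrt p"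
    proof (intro mult_right_mono mult_left_mono power_mono)
      have "2 ^ card (prime_factors (p - 1)) \<le> K * real (p - 1) powr \<delta>" using p1 by (intro K(2)) simp
      also have "\<dots> \<le> K * real p powr \<delta>"
        using K(1) \<open>\<delta> > 0\<close> by (intro mult_left_mono powr_mono2) auto
      finally show "2 ^ card (prime_factors (p - 1)) \<le> K * real p powr \<delta>" .
    qed auto
    also have "(K * real p powr \<delta>) ^ s = K ^ s * real p powr \<epsilon>"
    proof -
      have "(real p powr \<delta>) ^ s = real p powr (\<delta> * real s)" using p1 by (subst powr_power) (simp_all add: mult.commute)
      also have "\<delta> * real s = \<epsilon>" by (simp add: \<delta>_def s_def)
      finally show ?thesis by (simp only: power_mult_distrib)
    qed
    also have "3 * real s * (K ^ s * real p powr \<epsilon>) * sqrt p = C * (real p powr (1 / 2) * real p powr \<epsilon>)"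
      using p1 by (simp add: C_def powr_half_sqrt)
    also have "real p powr (1 / 2) * real p powr \<epsilon> = real p powr (1 / 2 + \<epsilon>)" by (simp add: powr_add)
    finally show ?thesis .
  qed
  moreover have "C > 0" using K(1) by (simp add: C_def s_def)
  ultimately show ?thesis by (intro exI[of _ C] exI[of _ "s + 1"]) auto
qed

end
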